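(* Let $q\in(0,1)$, $\nu>-1$ and $s\in\{2,3\}$. Then the radius of uniform convexity of $z\mapsto g_\nu^{(s)}(z;q)$ is the smallest positive root $r$ of the equation $$(2\nu-1)(\nu-1)J_{\nu}^{(s)}(r;q)+(5-4\nu)\,r\,\big(J_{\nu}^{(s)}\big)^{\prime}(r;q)+2r^2\big(J_{\nu}^{(s)}\big)^{\prime\prime}(r;q)=0,$$ where primes denote differentiation with respect to the variable $r$.
   Context: For $a\in\mathbb{C}$ and $q\in(0,1)$ let $(a;q)_0=1$, $(a;q)_n=\prod_{k=1}^{n}(1-aq^{k-1})$, $(a;q)_\infty=\prod_{k\ge1}(1-aq^{k-1})$. For $\nu>-1$, Jackson's second and third (Hahn–Exton) $q$-Bessel functions are $$J_{\nu}^{(2)}(z;q)=\frac{(q^{\nu+1};q)_{\infty}}{(q;q)_{\infty}}\sum_{n\geq0}\frac{(-1)^{n}(z/2)^{2n+\nu}}{(q;q)_{n}(q^{\nu+1};q)_{n}}q^{n(n+\nu)},\qquad J_{\nu}^{(3)}(z;q)=\frac{(q^{\nu+1};q)_{\infty}}{(q;q)_{\infty}}\sum_{n\geq0}\frac{(-1)^{n}z^{2n+\nu}}{(q;q)_{n}(q^{\nu+1};q)_{n}}q^{n(n+1)/2}.$$ Let $c_\nu(q)=(q;q)_\infty/(q^{\nu+1};q)_\infty$. Define $g_\nu^{(2)}(z;q)=2^\nu c_\nu(q)z^{1-\nu}J_\nu^{(2)}(z;q)$ and $g_\nu^{(3)}(z;q)=c_\nu(q)z^{1-\nu}J_\nu^{(3)}(z;q)$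 (entire functions with $g(0)=0$, $g'(0)=1$). For an analytic function $f$ with $f(0)=0,f'(0)=1$, its radius of uniform convexity is $r^{uc}(f)=\sup\{r>0: f \text{ is analytic on } \mathbb{D}_r,\ f'\neq0 \text{ on } \mathbb{D}_r, \text{ and } \Re\big(1+\tfrac{zf''(z)}{f'(z)}\big)>\big|\tfrac{zf''(z)}{f'(z)}\big| \text{ for all } z\in\mathbb{D}_r\}$, where $\mathbb{D}_r=\{z\in\mathbb{C}:|z|<r\}$. *)

theory Defs
  imports "HOL-Analysis.Analysis"
begin

definition qpoch :: "real \<Rightarrow> real \<Rightarrow> nat \<Rightarrow> real" where
  "qpoch a q n = (\<Prod>k<n. 1 - a * q ^ k)"

definition qpoch_inf :: "real \<Rightarrow> real \<Rightarrow> real" where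
  "qpoch_inf a q = (\<Prod>k. 1 - a * q ^ k)"

definition cnu :: "real \<Rightarrow> real \<Rightarrow> real" where
  "cnu \<nu> q = qpoch_inf q q / qpoch_inf (q powr (\<nu> + 1)) q"

text \<open>Jackson's second (s = 2) and third / Hahn-Exton (s = 3) q-Bessel functions,
  as functions of a complex variable (principal branch of the power z^nu).\<close>
definition qJ :: "nat \<Rightarrow> real \<Rightarrow> real \<Rightarrow> complex \<Rightarrow> complex" where
  "qJ s \<nu> q z =
    (if s = 2 then
       of_real (1 / cnu \<nu> q) * (\<Sum>n. of_real ((-1) ^ n * q powr (real n * (real n + \<nu>))
            / (qpoch q q n * qpoch (q powr (\<nu> + 1)) q n)) * (z / 2) powr of_real (2 * real n + \<nu>))
     else
       of_real (1 / cnu \<nu> q) * (\<Sum>n. of_real ((-1) ^ n * q powr (real n * (real n + 1) / 2)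
            / (qpoch q q n * qpoch (q powr (\<nu> + 1)) q n)) * z powr of_real (2 * real n + \<nu>)))"

definition qJr :: "nat \<Rightarrow> real \<Rightarrow> real \<Rightarrow> real \<Rightarrow> real" where
  "qJr s \<nu> q r =
    (if s = 2 then
       (1 / cnu \<nu> q) * (\<Sum>n. ((-1) ^ n * q powr (real n * (real n + \<nu>))
            / (qpoch q q n * qpoch (q powr (\<nu> + 1)) q n)) * (r / 2) powr (2 * real n + \<nu>))
     else
       (1 / cnu \<nu> q) * (\<Sum>n. ((-1) ^ n * q powr (real n * (real n + 1) / 2)
            / (qpoch q q n * qpoch (q powr (\<nu> + 1)) q n)) * r powr (2 * real n + \<nu>)))"

definition qg :: "nat \<Rightarrow> real \<Rightarrow> real \<Rightarrow> complex \<Rightarrow> complex" where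
  "qg s \<nu> q z =
    (if s = 2 then of_real (2 powr \<nu> * cnu \<nu> q) * z powr of_real (1 - \<nu>) * qJ 2 \<nu> q z
     else of_real (cnu \<nu> q) * z powr of_real (1 - \<nu>) * qJ 3 \<nu> q z)"

definition radius_uc :: "(complex \<Rightarrow> complex) \<Rightarrow> real" where
  "radius_uc f = Sup {r. r > 0 \<and> f holomorphic_on ball 0 r \<and>
      (\<forall>z\<in>ball 0 r. deriv f z \<noteq> 0 \<and>
         Re (1 + z * deriv (deriv f) z / deriv f z) > cmod (z * deriv (deriv f) z / deriv f z))}"

end

theory Submission
  imports Defs "HOL-Complex_Analysis.Complex_Analysis"
begin

text \<open>
  Write \<open>g z = z A(z\<^sup>2)\<close> and \<open>g' z = E(z\<^sup>2)\<close> with \<open>E = A + 2 w A'\<close>. The equation in the statement says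
  \<open>H(r\<^sup>2) = 0\<close> for \<open>H = E + 4 w E'\<close>. The function \<open>A\<close> is a limit of polynomials whose zeros are positive
  with consecutive quotients at least \<open>1/q\<close>: this separation is inherited by
  \<open>P(w) - \<kappa> w P(q w)\<close> and \<open>P(w) - c P(q w)\<close> for \<open>0 \<le> c < 1\<close>, which build up the \<open>q\<close>-binomial and
  \<open>(q\<^bsup>\<nu>+1\<^esup>; q)\<close> factors of the coefficients. By Rolle's theorem \<open>E\<close> is then a limit of polynomials with
  positive zeros, so as long as \<open>E > 0\<close> on \<open>[0, \<rho>]\<close> we have \<open>\<bar>w E'(w) / E(w)\<bar> \<le> - \<rho> E'(\<rho>) / E(\<rho>)\<close> for
  \<open>\<bar>w\<bar> \<le> \<rho>\<close>. Hence \<open>\<bar>z g''(z) / g'(z)\<bar> < 1/2\<close> inside the disc whose radius is the first zero of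
  \<open>r \<mapsto> H(r\<^sup>2)\<close>, with equality at that zero, where uniform convexity breaks down.
\<close>

subsection \<open>Polynomials with \<open>q\<close>-separated positive zeros\<close>

definition root_prod :: "(nat \<Rightarrow> real) \<Rightarrow> nat \<Rightarrow> real poly" where
  "root_prod x N = (\<Prod>i<N. [:1, - 1 / x i:])"

lemma poly_root_prod: "poly (root_prod x N) w = (\<Prod>i<N. 1 - w / x i)"
  by (simp add: root_prod_def poly_prod)

lemma degree_root_prod_le: "degree (root_prod x N) \<le> N"
proof -
  have "degree (root_prod x N) \<le> (\<Sum>i<N. degree [:1, - 1 / x i:])"
    unfolding root_prod_def by (rule degree_prod_sum_le[unfolded o_def]) simp
  also have "\<dots> \<le> (\<Sum>i<N. 1)" by (intro sum_mono) auto
  finally show ?thesis by simp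
qed

lemma root_prod_eq_0:
  assumes "i < N" "x i \<noteq> 0"
  shows "poly (root_prod x N) (x i) = 0"
  using assms by (auto simp: poly_root_prod prod_zero_iff)

text \<open>\<open>N\<close> distinct nonzero zeros and the value 1 at 0 are \<open>N + 1\<close>
  interpolation conditions, enough to fix a polynomial of degree at most \<open>N\<close>. In this
  way zeros found by intermediate values or by Rolle's theorem become complete
  factorisations.\<close>

lemma eq_root_prodI:
  assumes "inj_on y {..<N}" "\<And>i. i < N \<Longrightarrow> y i \<noteq> 0" "\<And>i. i < N \<Longrightarrow> poly p (y i) = 0"
    and "degree p \<le> N" "poly p 0 = 1"
  shows "p = root_prod y N"
proof (rule poly_eqI_degree[where A = "insert 0 (y ` {..<N})"])
  have "card (insert 0 (y ` {..<N})) = Suc N"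
    using assms(1,2) by (subst card_insert_disjoint) (auto simp: card_image)
  then show "degree p < card (insert 0 (y ` {..<N}))"
    "degree (root_prod y N) < card (insert 0 (y ` {..<N}))"
    using assms(4) degree_root_prod_le[of y N] by simp_all
next
  fix w assume "w \<in> insert 0 (y ` {..<N})"
  then show "poly p w = poly (root_prod y N) w"
    using assms(2,3,5) root_prod_eq_0[of _ N y] by (auto simp: poly_root_prod)
qed

text \<open>The first \<open>i\<close> factors are nonpositive and the others nonnegative. All
  comparisons are weak, so that \<open>w\<close> may itself be a zero.\<close>

lemma root_prod_sign:
  assumes "i \<le> N" "\<And>j. j < N \<Longrightarrow> 0 < x j"
    and "\<And>j. j < i \<Longrightarrow> x j \<le> w" "\<And>j. i \<le> j \<Longrightarrow> j < N \<Longrightarrow> w \<le> x j"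
  shows "0 \<le> (- 1) ^ i * poly (root_prod x N) w"
proof -
  have "(\<Prod>j<N. 1 - w / x j) = (\<Prod>j<i. 1 - w / x j) * (\<Prod>j\<in>{i..<N}. 1 - w / x j)"
    using assms(1) by (subst prod.union_disjoint[symmetric]) (auto intro!: prod.cong)
  moreover have "(- 1) ^ i * (\<Prod>j<i. 1 - w / x j) = (\<Prod>j<i. w / x j - 1)"
  proof -
    have "(- 1) ^ i * (\<Prod>j<i. 1 - w / x j) = (\<Prod>j<i. (-1) * (1 - w / x j))"
      by (subst prod.distrib) simp
    then show ?thesis by simp
  qed
  ultimately have "(- 1) ^ i * poly (root_prod x N) w
      = (\<Prod>j<i. w / x j - 1) * (\<Prod>j\<in>{i..<N}. 1 - w / x j)"
    by (metis (no_types, lifting) mult.assoc poly_root_prod)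
  moreover have "0 \<le> (\<Prod>j<i. w / x j - 1)"
    using assms by (intro prod_nonneg) auto
  moreover have "0 \<le> (\<Prod>j\<in>{i..<N}. 1 - w / x j)"
    using assms by (intro prod_nonneg) auto
  ultimately show ?thesis by simp
qed

text \<open>The dilate \<open>P (q * w)\<close> has the zeros \<open>x i / q\<close>. Quotients of
  at least \<open>1 / q\<close> put each of them between \<open>x i\<close> and the next zero of
  \<open>P\<close>, which makes sign counting for combinations of \<open>P\<close> and its dilate
  possible.\<close>

definition q_separated :: "real \<Rightarrow> (nat \<Rightarrow> real) \<Rightarrow> nat \<Rightarrow> bool" where
  "q_separated q x N \<longleftrightarrow> (\<forall>i<N. 0 < x i) \<and> (\<forall>j<N. \<forall>i<j. x i \<le> q * x j)"

lemma q_separated_less: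
  assumes "q_separated q x N" "q < 1" "i < j" "j < N"
  shows "x i < x j"
proof -
  have "x i \<le> q * x j" "0 < x j" using assms by (auto simp: q_separated_def)
  moreover have "q * x j < x j" using assms(2) \<open>0 < x j\<close> by simp
  ultimately show ?thesis by linarith
qed

lemma q_separated_le:
  assumes "q_separated q x N" "q < 1" "i \<le> j" "j < N"
  shows "x i \<le> x j"
  using q_separated_less[OF assms(1,2), of i j] assms(3,4) by (cases "i = j") auto

lemma q_separated_inj_on:
  assumes "q_separated q x N" "q < 1"
  shows "inj_on x {..<N}"
proof (rule inj_onI)
  fix i j assume ij: "i \<in> {..<N}" "j \<in> {..<N}" "x i = x j"
  show "i = j"
    using q_separated_less[OF assms, of i j] q_separated_less[OF assms, of j i] ij
    by (cases i j rule: linorder_cases) auto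
qed

text \<open>Both \<open>P\<close> and its dilate \<open>P (q \<cdot>)\<close> have sign \<open>(-1)^i\<close> on \<open>[x (i - 1) / q, x i]\<close>.\<close>
lemma dilation_root_between:
  assumes q: "0 < q" "q < 1" and sep: "q_separated q x N" and "i < N"
    and R: "\<And>w. poly R w = poly (root_prod x N) w - \<phi> w * poly (root_prod x N) (q * w)"
    and \<phi>: "\<And>w. 0 \<le> w \<Longrightarrow> 0 \<le> \<phi> w" "\<phi> 0 < 1"
  shows "\<exists>y. 0 < y \<and> y \<le> x i \<and> (\<forall>j<i. x j \<le> q * y) \<and> poly R y = 0"
proof -
  define P where "P = root_prod x N"
  \<comment> \<open>\<open>x (i - 1) / q\<close> is the last zero of the dilate before
    \<open>x i\<close>; for \<open>i = 0\<close> the origin takes its place.\<close>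
  define l where "l = (if i = 0 then 0 else x (i - 1) / q)"
  have pos: "0 < x j" if "j < N" for j using sep that by (auto simp: q_separated_def)
  have xl: "x j \<le> q * l" if "j < i" for j
    using q_separated_le[OF sep q(2), of j "i - 1"] that \<open>i < N\<close> q by (auto simp: l_def)
  have l0: "0 \<le> l" using pos[of "i - 1"] \<open>i < N\<close> q by (auto simp: l_def less_imp_le)
  have li: "l \<le> x i"
  proof (cases "i = 0")
    case False
    then have "x (i - 1) \<le> q * x i" using sep \<open>i < N\<close> by (auto simp: q_separated_def)
    then show ?thesis using False q by (auto simp: l_def field_simps)
  qed (use pos \<open>i < N\<close> in \<open>auto simp: l_def less_imp_le\<close>)
  have sgn: "0 \<le> (- 1) ^ i * poly P w" if "q * l \<le> w" "w \<le> x i" for w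
    unfolding P_def
  proof (rule root_prod_sign)
    show "x j \<le> w" if "j < i" for j using xl[OF that] \<open>q * l \<le> w\<close> by simp
    show "w \<le> x j" if "i \<le> j" "j < N" for j
      using q_separated_le[OF sep q(2) that] \<open>w \<le> x i\<close> by simp
  qed (use \<open>i < N\<close> pos in auto)
  have qle: "q * w \<le> w" if "0 \<le> w" for w
    using that q by (simp add: mult_left_le_one_le)
  \<comment> \<open>At \<open>l\<close> the dilate vanishes and only \<open>P\<close> is left; for
    \<open>i = 0\<close> the value is \<open>1 - \<phi> 0\<close>.\<close>
  have left: "0 \<le> (- 1) ^ i * poly R l"
  proof (cases "i = 0")
    case True
    then show ?thesis using \<phi>(2) by (auto simp: l_def R poly_root_prod)
  next
    case False
    then have "poly P (q * l) = 0"
      using root_prod_eq_0[of "i - 1" N x] less_imp_diff_less[OF \<open>i < N\<close>, of 1] pos[of "i - 1"] q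
      by (auto simp: l_def P_def)
    then show ?thesis using sgn[of l] qle[OF l0] li by (simp add: R P_def)
  qed
  \<comment> \<open>At \<open>x i\<close> only the dilate is left, and it enters with a minus
    sign.\<close>
  have right: "(- 1) ^ i * poly R (x i) \<le> 0"
  proof -
    have "poly P (x i) = 0" using root_prod_eq_0[of i N x] pos[of i] \<open>i < N\<close> by (auto simp: P_def)
    moreover have sgn_q: "0 \<le> (- 1) ^ i * poly P (q * x i)"
    proof (rule sgn)
      show "q * l \<le> q * x i" using li q by (intro mult_left_mono) auto
      show "q * x i \<le> x i" using pos[OF \<open>i < N\<close>] by (intro qle) simp
    qed
    have "0 \<le> \<phi> (x i)" using pos[OF \<open>i < N\<close>] by (intro \<phi>) simp
    from mult_nonneg_nonneg[OF this sgn_q]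
    have "0 \<le> \<phi> (x i) * ((- 1) ^ i * poly P (q * x i))" .
    ultimately show ?thesis by (simp add: R P_def mult_ac)
  qed
  have "\<exists>y\<ge>l. y \<le> x i \<and> (- 1) ^ i * poly R y = 0"
    by (rule IVT2') (use left right li in \<open>auto intro!: continuous_intros\<close>)
  then obtain y where y: "l \<le> y" "y \<le> x i" "poly R y = 0" by auto
  have "y \<noteq> 0" using y(3) \<phi>(2) by (auto simp: R poly_root_prod)
  moreover have "x j \<le> q * y" if "j < i" for j
    using order_trans[OF xl[OF that] mult_left_mono[OF y(1), of q]] q by simp
  ultimately show ?thesis using y l0 by (intro exI[of _ y]) auto
qed

text \<open>The factor \<open>w\<close> raises the degree by one, so one more zero is due, beyond
  \<open>x (N - 1) / q\<close>. It exists because the subtracted term outweighs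
  \<open>root_prod x N\<close> for large \<open>w\<close> and forces a change of sign.\<close>

lemma dilation_root_last:
  assumes q: "0 < q" "q < 1" and sep: "q_separated q x N" and "0 < \<kappa>"
    and R: "\<And>w. poly R w = poly (root_prod x N) w - \<kappa> * w * poly (root_prod x N) (q * w)"
  shows "\<exists>y. 0 < y \<and> (\<forall>j<N. x j \<le> q * y) \<and> poly R y = 0"
proof -
  define P where "P = root_prod x N"
  define l where "l = (if N = 0 then 0 else x (N - 1) / q)"
  have pos: "0 < x j" if "j < N" for j using sep that by (auto simp: q_separated_def)
  have xl: "x j \<le> q * l" if "j < N" for j
    using q_separated_le[OF sep q(2), of j "N - 1"] that q by (auto simp: l_def)
  have l0: "0 \<le> l" using pos[of "N - 1"] q by (auto simp: l_def less_imp_le)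
  \<comment> \<open>From \<open>2 * l\<close> on, each factor of \<open>P\<close> at
    \<open>W\<close> is at most \<open>2 / q\<close> times the matching factor at
    \<open>q * W\<close>, up to sign. The second summand makes \<open>\<kappa> * W\<close> at least
    \<open>(2 / q) ^ N\<close>, which compensates all \<open>N\<close> ratios.\<close>
  define W where "W = 2 * l + (2 / q) ^ N / \<kappa>"
  have "0 < (2 / q) ^ N / \<kappa>" using q \<open>0 < \<kappa>\<close> by simp
  then have W: "2 * l \<le> W" "0 < W" "(2 / q) ^ N \<le> \<kappa> * W"
    using l0 \<open>0 < \<kappa>\<close> by (auto simp: W_def field_simps)
  have alt: "(- 1) ^ N * poly P w = (\<Prod>j<N. w / x j - 1)" for w
  proof -
    have "(- 1) ^ N * (\<Prod>j<N. 1 - w / x j) = (\<Prod>j<N. (-1) * (1 - w / x j))"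
      by (subst prod.distrib) simp
    then show ?thesis by (simp add: P_def poly_root_prod)
  qed
  have left: "0 \<le> (- 1) ^ N * poly R l"
  proof (cases "N = 0")
    case True
    then show ?thesis by (auto simp: l_def R poly_root_prod)
  next
    case False
    then have "poly P (q * l) = 0"
      using root_prod_eq_0[of "N - 1" N x] pos[of "N - 1"] q by (auto simp: l_def P_def)
    moreover have "0 \<le> (- 1) ^ N * poly P l"
      unfolding P_def
    proof (rule root_prod_sign)
      show "x j \<le> l" if "j < N" for j
        using xl[OF that] q l0 mult_left_le_one_le[of l q] by simp
    qed (use pos in auto)
    ultimately show ?thesis by (simp add: R P_def)
  qed
  have right: "(- 1) ^ N * poly R W \<le> 0"
  proof -
    have "(\<Prod>j<N. W / x j - 1) \<le> (\<Prod>j<N. (2 / q) * (q * W / x j - 1))"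
    proof (intro prod_mono conjI)
      fix j assume "j \<in> {..<N}"
      then have j: "x j \<le> q * l" "0 < x j" using xl pos by auto
      have "q * (2 * l) \<le> q * W" using W q by (intro mult_left_mono) auto
      then have *: "2 * x j \<le> q * W" using j by simp
      have "q * W \<le> W" using q W by (simp add: mult_left_le_one_le)
      then show "0 \<le> W / x j - 1" using * j by (simp add: field_simps)
      have "2 \<le> q * W / x j" using * j by (simp add: field_simps)
      then have "2 / q \<le> W / x j" using q j by (simp add: field_simps)
      then show "W / x j - 1 \<le> (2 / q) * (q * W / x j - 1)"
      proof -
        have "(2 / q) * (q * W / x j - 1) = 2 * (W / x j) - 2 / q"
          using q j by (simp add: field_simps)
        moreover have "0 < 2 / q" using q by simp
        ultimately show ?thesis using \<open>2 / q \<le> W / x j\<close> by linarith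
      qed
    qed
    also have "\<dots> = (2 / q) ^ N * (\<Prod>j<N. q * W / x j - 1)"
      by (subst prod.distrib) simp
    also have "\<dots> \<le> (\<kappa> * W) * (\<Prod>j<N. q * W / x j - 1)"
    proof (intro mult_right_mono W prod_nonneg ballI)
      fix j assume "j \<in> {..<N}"
      then have j: "x j \<le> q * l" "0 < x j" using xl pos by auto
      have "q * (2 * l) \<le> q * W" using W q by (intro mult_left_mono) auto
      then show "0 \<le> q * W / x j - 1" using j by (simp add: field_simps)
    qed
    finally show ?thesis
      using alt[of W] alt[of "q * W"] by (simp add: R P_def algebra_simps)
  qed
  have "\<exists>y\<ge>l. y \<le> W \<and> (- 1) ^ N * poly R y = 0"
    by (rule IVT2') (use left right W l0 in \<open>auto intro!: continuous_intros\<close>)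
  then obtain y where y: "l \<le> y" "poly R y = 0" by auto
  have "y \<noteq> 0" using y(2) by (auto simp: R poly_root_prod)
  moreover have "x j \<le> q * y" if "j < N" for j
    using order_trans[OF xl[OF that] mult_left_mono[OF y(1), of q]] q by simp
  ultimately show ?thesis using y l0 by (intro exI[of _ y]) auto
qed

lemma interlacing_q_separated:
  assumes "0 < q" "q < 1"
    and "\<And>i. i < M \<Longrightarrow> 0 < y i" "\<And>i j. i < M \<Longrightarrow> j < i \<Longrightarrow> y j \<le> x j \<and> x j \<le> q * y i"
  shows "q_separated q y M"
  unfolding q_separated_def using assms by (meson order_trans)

text \<open>Coefficient \<open>n\<close> is multiplied by \<open>(1 - c * q ^ n) / (1 - c)\<close>,
  which will supply one more factor of a \<open>q\<close>-shifted factorial. The scaling restores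
  the constant term 1; the zeros come from \<open>dilation_root_between\<close> with the constant
  function \<open>c\<close>.\<close>

lemma q_separated_diff_dilation:
  assumes q: "0 < q" "q < 1" and sep: "q_separated q x N" and c: "0 \<le> c" "c < 1"
  shows "\<exists>y. q_separated q y N \<and>
    smult (1 / (1 - c)) (root_prod x N - smult c (root_prod x N \<circ>\<^sub>p [:0, q:])) = root_prod y N"
proof -
  define R where "R = root_prod x N - smult c (root_prod x N \<circ>\<^sub>p [:0, q:])"
  have R: "poly R w = poly (root_prod x N) w - c * poly (root_prod x N) (q * w)" for w
    by (simp add: R_def poly_pcompose mult.commute)
  have "\<forall>i. \<exists>y. i < N \<longrightarrow> 0 < y \<and> y \<le> x i \<and> (\<forall>j<i. x j \<le> q * y) \<and> poly R y = 0"
    using dilation_root_between[OF q sep _ R] c by blast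
  then obtain y where y: "\<And>i. i < N \<Longrightarrow>
      0 < y i \<and> y i \<le> x i \<and> (\<forall>j<i. x j \<le> q * y i) \<and> poly R (y i) = 0"
    by metis
  have sy: "q_separated q y N"
    by (rule interlacing_q_separated[OF q, where x = x]) (use y in auto)
  have "degree (root_prod x N \<circ>\<^sub>p [:0, q:]) \<le> N"
    using degree_pcompose_le[of "root_prod x N" "[:0, q:]"] degree_root_prod_le[of x N] q
    by simp
  then have "degree R \<le> N"
    unfolding R_def using degree_root_prod_le[of x N]
    by (intro degree_diff_le) (auto intro: order_trans[OF degree_smult_le])
  then have "smult (1 / (1 - c)) R = root_prod y N"
  proof (intro eq_root_prodI q_separated_inj_on[OF sy q(2)])
    show "y i \<noteq> 0" "poly (smult (1 / (1 - c)) R) (y i) = 0" if "i < N" for i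
      using y[OF that] by auto
  qed (use c in \<open>simp_all add: R poly_root_prod\<close>)
  then show ?thesis using sy unfolding R_def by blast
qed

text \<open>The first \<open>N\<close> zeros come from \<open>dilation_root_between\<close> with
  \<open>\<phi> w = \<kappa> * w\<close>, the last one from \<open>dilation_root_last\<close>. This
  raises the degree in the recursion for the coefficients with \<open>j = 2\<close>.\<close>

lemma q_separated_diff_dilation_pCons:
  assumes q: "0 < q" "q < 1" and sep: "q_separated q x N" and "0 < \<kappa>"
  shows "\<exists>y. q_separated q y (Suc N) \<and>
    root_prod x N - smult \<kappa> (pCons 0 (root_prod x N \<circ>\<^sub>p [:0, q:])) = root_prod y (Suc N)"
proof -
  define R where "R = root_prod x N - smult \<kappa> (pCons 0 (root_prod x N \<circ>\<^sub>p [:0, q:]))"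
  have R: "poly R w = poly (root_prod x N) w - \<kappa> * w * poly (root_prod x N) (q * w)" for w
    by (simp add: R_def poly_pcompose mult_ac)
  have "\<exists>y. 0 < y \<and> (i < N \<longrightarrow> y \<le> x i) \<and> (\<forall>j<i. x j \<le> q * y) \<and> poly R y = 0"
    if "i < Suc N" for i
  proof (cases "i < N")
    case True
    then show ?thesis
      using dilation_root_between[OF q sep True R] \<open>0 < \<kappa>\<close> by auto
  next
    case False
    then show ?thesis
      using dilation_root_last[OF q sep \<open>0 < \<kappa>\<close> R] that by (auto simp: less_Suc_eq)
  qed
  then obtain y where y: "\<And>i. i < Suc N \<Longrightarrow>
      0 < y i \<and> (i < N \<longrightarrow> y i \<le> x i) \<and> (\<forall>j<i. x j \<le> q * y i) \<and> poly R (y i) = 0"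
    by metis
  have sy: "q_separated q y (Suc N)"
    by (rule interlacing_q_separated[OF q, where x = x]) (use y in auto)
  have "degree (root_prod x N \<circ>\<^sub>p [:0, q:]) \<le> N"
    using degree_pcompose_le[of "root_prod x N" "[:0, q:]"] degree_root_prod_le[of x N] q
    by simp
  then have "degree (pCons 0 (root_prod x N \<circ>\<^sub>p [:0, q:])) \<le> Suc N"
    by (simp add: degree_pCons_eq_if)
  then have "degree R \<le> Suc N"
    unfolding R_def using degree_root_prod_le[of x N]
    by (intro degree_diff_le) (auto intro: order_trans[OF degree_smult_le])
  then have "R = root_prod y (Suc N)"
  proof (intro eq_root_prodI q_separated_inj_on[OF sy q(2)])
    show "y i \<noteq> 0" "poly R (y i) = 0" if "i < Suc N" for i using y[OF that] by auto
  qed (simp_all add: R poly_root_prod)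
  then show ?thesis using sy unfolding R_def by blast
qed

text \<open>\<open>P + 2 w P'\<close> is \<open>2 \<surd>w\<close> times the derivative of \<open>\<surd>w P\<close>, so Rolle's theorem yields a
  root between any two consecutive elements of \<open>0, x 0, x 1, \<dots>\<close>.\<close>
lemma root_prod_add_deriv:
  assumes q: "q < 1" and sep: "q_separated q x N"
  shows "\<exists>u. (\<forall>i<N. 0 < u i) \<and>
    root_prod x N + smult 2 (pCons 0 (pderiv (root_prod x N))) = root_prod u N"
proof -
  define P where "P = root_prod x N"
  define R where "R = P + smult 2 (pCons 0 (pderiv P))"
  have pos: "0 < x j" if "j < N" for j using sep that by (auto simp: q_separated_def)
  have "\<exists>u. (if i = 0 then 0 else x (i - 1)) < u \<and> u < x i \<and> poly R u = 0" if "i < N" for i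
  proof -
    define l where "l = (if i = 0 then 0 else x (i - 1))"
    have l: "0 \<le> l" "l < x i"
      using pos[of i] pos[of "i - 1"] q_separated_less[OF sep q, of "i - 1" i] that
      by (auto simp: l_def less_imp_le)
    have der: "((\<lambda>w. sqrt w * poly P w) has_field_derivative
        poly P w / (2 * sqrt w) + sqrt w * poly (pderiv P) w) (at w)" if "0 < w" for w
      using that by (auto intro!: derivative_eq_intros simp: field_simps)
    have "\<exists>z. l < z \<and> z < x i \<and> DERIV (\<lambda>w. sqrt w * poly P w) z :> 0"
    proof (rule Rolle)
      \<comment> \<open>At \<open>l = 0\<close> the factor \<open>sqrt l\<close> vanishes; at every
        other end point \<open>P\<close> does.\<close>
      show "sqrt l * poly P l = sqrt (x i) * poly P (x i)"
        using that root_prod_eq_0[of i N x] root_prod_eq_0[of "i - 1" N x] pos[of i] pos[of "i - 1"]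
          less_imp_diff_less[OF that, of 1]
        by (auto simp: l_def P_def)
      show "(\<lambda>w. sqrt w * poly P w) differentiable at z" if "l < z" "z < x i" for z
        using der[of z] that l by (auto simp: real_differentiable_def)
    qed (use l in \<open>auto intro!: continuous_intros\<close>)
    then obtain z where z: "l < z" "z < x i" "DERIV (\<lambda>w. sqrt w * poly P w) z :> 0" by auto
    have "0 < z" using z l by simp
    from DERIV_unique[OF z(3) der[OF this]]
    have "poly P z / (2 * sqrt z) + sqrt z * poly (pderiv P) z = 0" by simp
    then have "(poly P z / (2 * sqrt z) + sqrt z * poly (pderiv P) z) * (2 * sqrt z) = 0" by simp
    moreover have "(poly P z / (2 * sqrt z) + sqrt z * poly (pderiv P) z) * (2 * sqrt z)
        = poly P z + 2 * (sqrt z * sqrt z) * poly (pderiv P) z"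
      using \<open>0 < z\<close> by (simp add: field_simps)
    ultimately have "poly R z = 0" using \<open>0 < z\<close> by (simp add: R_def)
    then show ?thesis using z unfolding l_def by blast
  qed
  then obtain u where u: "\<And>i. i < N \<Longrightarrow>
      (if i = 0 then 0 else x (i - 1)) < u i \<and> u i < x i \<and> poly R (u i) = 0"
    by metis
  have upos: "0 < u i" if "i < N" for i
    using u[OF that] pos[of "i - 1"] less_imp_diff_less[OF that, of 1] by (auto split: if_splits)
  have mono: "u i < u j" if "i < j" "j < N" for i j
  proof -
    have "u i < x i" using u[of i] that by auto
    also have "x i \<le> x (j - 1)" using q_separated_le[OF sep q, of i "j - 1"] that by auto
    also have "\<dots> < u j" using u[of j] that by auto
    finally show ?thesis .
  qed
  have inj: "inj_on u {..<N}"
  proof (rule inj_onI)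
    fix i j assume "i \<in> {..<N}" "j \<in> {..<N}" "u i = u j"
    then show "i = j" using mono[of i j] mono[of j i] by (cases i j rule: linorder_cases) auto
  qed
  have "degree R \<le> N"
  proof -
    have "degree P \<le> N" by (simp add: P_def degree_root_prod_le)
    moreover have "degree (pCons 0 (pderiv P)) \<le> N"
    proof (cases "pderiv P = 0")
      case False
      then have "degree P \<noteq> 0" by (auto simp: pderiv_eq_0_iff)
      then show ?thesis using False \<open>degree P \<le> N\<close> by (simp add: degree_pderiv)
    qed simp
    ultimately show ?thesis
      unfolding R_def by (intro degree_add_le) (auto intro: order_trans[OF degree_smult_le])
  qed
  then have "R = root_prod u N"
  proof (intro eq_root_prodI inj)
    show "u i \<noteq> 0" "poly R (u i) = 0" if "i < N" for i using upos[OF that] u[OF that] by auto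
  qed (simp_all add: R_def P_def poly_root_prod)
  then show ?thesis using upos unfolding R_def P_def by blast
qed

subsection \<open>Polynomial approximations with \<open>q\<close>-binomial coefficients\<close>

text \<open>Truncated subtraction is intended: for \<open>n > N\<close> the factor with
  \<open>k = N\<close> is \<open>1 - q ^ 0 = 0\<close>, so the value is 0 as for ordinary binomial
  coefficients.\<close>

definition gauss_binom :: "real \<Rightarrow> nat \<Rightarrow> nat \<Rightarrow> real" where
  "gauss_binom q N n = (\<Prod>k<n. 1 - q ^ (N - k)) / qpoch q q n"

lemma qpoch_0 [simp]: "qpoch a q 0 = 1"
  by (simp add: qpoch_def)

lemma qpoch_Suc: "qpoch a q (Suc n) = qpoch a q n * (1 - a * q ^ n)"
  by (simp add: qpoch_def)

lemma mult_power_less_1: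
  fixes a q :: real
  assumes "0 < q" "q < 1" "a < 1"
  shows "a * q ^ n < 1"
proof (cases "0 \<le> a")
  case True
  then have "a * q ^ n \<le> a * 1" using assms by (intro mult_left_mono power_le_one) auto
  then show ?thesis using assms by simp
next
  case False
  then have "a * q ^ n \<le> 0" using assms by (intro mult_nonpos_nonneg) auto
  then show ?thesis by simp
qed

lemma qpoch_pos:
  assumes "0 < q" "q < 1" "a < 1"
  shows "0 < qpoch a q n"
  unfolding qpoch_def using mult_power_less_1[OF assms] by (intro prod_pos) auto

lemma gauss_binom_eq_0:
  assumes "N < n"
  shows "gauss_binom q N n = 0"
  using assms by (auto simp: gauss_binom_def intro!: bexI[of _ N])

text \<open>The \<open>q\<close>-Pascal rule has the weight \<open>q ^ (N - n)\<close> on the last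
  term; multiplying through by \<open>q ^ n\<close> turns it into \<open>q ^ N\<close> and keeps the
  rule valid for \<open>n > N\<close>, where every term is 0.\<close>

lemma gauss_binom_pascal:
  assumes q: "0 < q" "q < 1"
  shows "q ^ n * gauss_binom q (Suc N) (Suc n)
    = q ^ n * gauss_binom q N (Suc n) + q ^ N * gauss_binom q N n"
proof (cases "n \<le> N")
  case False
  then show ?thesis by (simp add: gauss_binom_eq_0)
next
  case True
  define P where "P = (\<Prod>k<n. 1 - q ^ (N - k))"
  define D where "D = qpoch q q n"
  have D: "0 < D" unfolding D_def using q by (intro qpoch_pos) auto
  have d: "q ^ Suc n < 1" using q by (intro power_Suc_less_one) auto
  have "gauss_binom q (Suc N) (Suc n) = (1 - q ^ Suc N) * P / (D * (1 - q ^ Suc n))"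
    by (simp add: gauss_binom_def prod.lessThan_Suc_shift qpoch_Suc P_def D_def del: prod.lessThan_Suc)
  moreover have "gauss_binom q N (Suc n) = P * (1 - q ^ (N - n)) / (D * (1 - q ^ Suc n))"
    by (simp add: gauss_binom_def qpoch_Suc P_def D_def)
  moreover have "gauss_binom q N n = P * (1 - q ^ Suc n) / (D * (1 - q ^ Suc n))"
    using d by (simp add: gauss_binom_def P_def D_def)
  moreover have "q ^ n * ((1 - q ^ Suc N) * P)
      = q ^ n * (P * (1 - q ^ (N - n))) + q ^ N * (P * (1 - q ^ Suc n))"
    using True by (simp add: algebra_simps flip: power_add)
  ultimately show ?thesis by (simp only: times_divide_eq_right add_divide_distrib)
qed

lemma gauss_binom_nonneg:
  assumes "0 < q" "q < 1"
  shows "0 \<le> gauss_binom q N n"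
  unfolding gauss_binom_def using assms qpoch_pos[of q q n]
  by (intro divide_nonneg_pos prod_nonneg) (auto intro: power_le_one)

lemma gauss_binom_le:
  assumes "0 < q" "q < 1"
  shows "gauss_binom q N n \<le> 1 / qpoch q q n"
  unfolding gauss_binom_def using assms qpoch_pos[of q q n]
  by (intro divide_right_mono prod_le_1) (auto intro: power_le_one)

lemma gauss_binom_tendsto:
  assumes "0 < q" "q < 1"
  shows "(\<lambda>N. gauss_binom q N n) \<longlonglongrightarrow> 1 / qpoch q q n"
proof -
  have "(\<lambda>N. q ^ (N - k)) \<longlonglongrightarrow> 0" for k
    by (rule LIMSEQ_offset[of _ k]) (use assms in \<open>auto intro: LIMSEQ_realpow_zero\<close>)
  then have "(\<lambda>N. gauss_binom q N n) \<longlonglongrightarrow> (\<Prod>k<n. 1 - 0) / qpoch q q n"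
    unfolding gauss_binom_def using qpoch_pos[of q q n] assms
    by (intro tendsto_intros) auto
  then show ?thesis by simp
qed

lemma Suc_choose_two: "Suc n choose 2 = n + (n choose 2)"
  by (simp add: numeral_2_eq_2)

text \<open>The finite \<open>q\<close>-binomial theorem: the zeros are \<open>1 / q ^ i\<close> for
  \<open>i < N\<close>, and appending the factor \<open>1 - q ^ N * w\<close> is the
  \<open>q\<close>-Pascal rule on coefficients.\<close>

lemma q_separated_gauss_binom_1:
  assumes q: "0 < q" "q < 1"
  shows "\<exists>x. q_separated q x N \<and>
    (\<forall>n. coeff (root_prod x N) n = (- 1) ^ n * gauss_binom q N n * q ^ (n choose 2))"
proof (intro exI conjI allI)
  let ?x = "\<lambda>i. 1 / q ^ i"
  have "?x i \<le> q * ?x j" if "i < j" for i j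
  proof -
    obtain k where "j = Suc (i + k)" using less_imp_Suc_add[OF \<open>i < j\<close>] by auto
    then have "q * ?x j = ?x i / q ^ k" using q by (simp add: power_add)
    moreover have "?x i / 1 \<le> ?x i / q ^ k"
      using q by (intro divide_left_mono) (auto intro: power_le_one)
    ultimately show ?thesis by simp
  qed
  then show "q_separated q ?x N" using q by (auto simp: q_separated_def)
  show "coeff (root_prod ?x N) n = (- 1) ^ n * gauss_binom q N n * q ^ (n choose 2)" for n
  proof (induction N arbitrary: n)
    case 0
    then show ?case
      by (cases n) (auto simp: root_prod_def gauss_binom_eq_0 gauss_binom_def binomial_eq_0)
  next
    case (Suc N)
    have *: "coeff (root_prod ?x (Suc N)) n
        = coeff (root_prod ?x N - smult (q ^ N) (pCons 0 (root_prod ?x N))) n"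
      by (simp add: root_prod_def coeff_pCons split: nat.split)
    show ?case
    proof (cases n)
      case 0
      then show ?thesis using Suc.IH[of 0] by (subst *) (simp add: gauss_binom_def binomial_eq_0)
    next
      case (Suc m)
      have choose: "q ^ (n choose 2) = q ^ m * q ^ (m choose 2)"
        by (simp add: Suc Suc_choose_two power_add)
      have "coeff (root_prod ?x (Suc N)) n = (- 1) ^ n * q ^ (m choose 2)
          * (q ^ m * gauss_binom q N (Suc m) + q ^ N * gauss_binom q N m)"
        using choose by (simp only: *) (simp add: Suc Suc.IH algebra_simps)
      then have "coeff (root_prod ?x (Suc N)) n = (- 1) ^ n * q ^ (m choose 2)
          * (q ^ m * gauss_binom q (Suc N) n)"
        by (simp only: gauss_binom_pascal[OF q, of m N] Suc)
      then show ?thesis by (simp only: choose mult_ac)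
    qed
  qed
qed

text \<open>The zeros arise by induction on \<open>N\<close> from
  \<open>P(w) - q ^ N * w * P(q * w)\<close>. On coefficients this is again the
  \<open>q\<close>-Pascal rule, the dilation supplying the additional power of \<open>q\<close> that
  the square requires.\<close>

lemma q_separated_gauss_binom_2:
  assumes q: "0 < q" "q < 1"
  shows "\<exists>x. q_separated q x N \<and>
    (\<forall>n. coeff (root_prod x N) n = (- 1) ^ n * gauss_binom q N n * (q ^ (n choose 2)) ^ 2)"
proof (induction N)
  case 0
  have "coeff (root_prod x 0) n = (- 1) ^ n * gauss_binom q 0 n * (q ^ (n choose 2)) ^ 2" for x n
    by (cases n) (auto simp: root_prod_def gauss_binom_eq_0 gauss_binom_def binomial_eq_0)
  then show ?case by (auto simp: q_separated_def)
next
  case (Suc N)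
  then obtain x where x: "q_separated q x N"
    "\<And>n. coeff (root_prod x N) n = (- 1) ^ n * gauss_binom q N n * (q ^ (n choose 2)) ^ 2" by auto
  define R where "R = root_prod x N - smult (q ^ N) (pCons 0 (root_prod x N \<circ>\<^sub>p [:0, q:]))"
  obtain y where y: "q_separated q y (Suc N)" "R = root_prod y (Suc N)"
    using q_separated_diff_dilation_pCons[OF q x(1), of "q ^ N"] q unfolding R_def by auto
  have "coeff R n = (- 1) ^ n * gauss_binom q (Suc N) n * (q ^ (n choose 2)) ^ 2" for n
  proof (cases n)
    case 0
    then show ?thesis using x(2)[of 0] by (simp add: R_def gauss_binom_def binomial_eq_0)
  next
    case (Suc m)
    have choose: "q ^ (n choose 2) = q ^ m * q ^ (m choose 2)"
      by (simp add: Suc Suc_choose_two power_add)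
    have "coeff R n = (- 1) ^ n * (q ^ (m choose 2)) ^ 2 *
        (q ^ m * (q ^ m * gauss_binom q N (Suc m) + q ^ N * gauss_binom q N m))"
      using choose
      by (simp add: R_def Suc x(2) coeff_pcompose_linear power2_eq_square algebra_simps)
    then have "coeff R n = (- 1) ^ n * (q ^ (m choose 2)) ^ 2 *
        (q ^ m * (q ^ m * gauss_binom q (Suc N) n))"
      by (simp only: gauss_binom_pascal[OF q, of m N] Suc)
    then show ?thesis by (simp only: choose power2_eq_square mult_ac)
  qed
  then show ?case using y by auto
qed

text \<open>Each step in \<open>M\<close> applies \<open>q_separated_diff_dilation\<close> with
  \<open>c = b * q ^ M\<close>. After many steps the quotient of factorials is close to
  \<open>1 / qpoch b q n\<close>, so the denominators of the Bessel coefficients appear although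
  only polynomials are involved.\<close>

lemma q_separated_gauss_binom_qpoch:
  assumes q: "0 < q" "q < 1" and b: "0 \<le> b" "b < 1" and j: "j \<in> {1, 2}"
  shows "\<exists>x. q_separated q x N \<and>
    (\<forall>n. coeff (root_prod x N) n = (- 1) ^ n * gauss_binom q N n * (q ^ (n choose 2)) ^ j
      * (qpoch b q (M + n) / (qpoch b q n * qpoch b q M)))"
proof (induction M)
  case 0
  have "qpoch b q n \<noteq> 0" for n using qpoch_pos[OF q b(2), of n] by simp
  then show ?case
    using j q_separated_gauss_binom_1[OF q, of N] q_separated_gauss_binom_2[OF q, of N] by auto
next
  case (Suc M)
  then obtain x where x: "q_separated q x N"
    "\<And>n. coeff (root_prod x N) n = (- 1) ^ n * gauss_binom q N n * (q ^ (n choose 2)) ^ j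
      * (qpoch b q (M + n) / (qpoch b q n * qpoch b q M))" by auto
  define c where "c = b * q ^ M"
  have c: "0 \<le> c" "c < 1" using b q mult_power_less_1[OF q b(2)] by (auto simp: c_def)
  define R where "R = smult (1 / (1 - c)) (root_prod x N - smult c (root_prod x N \<circ>\<^sub>p [:0, q:]))"
  obtain y where y: "q_separated q y N" "R = root_prod y N"
    using q_separated_diff_dilation[OF q x(1) c] unfolding R_def by auto
  have "coeff R n = (- 1) ^ n * gauss_binom q N n * (q ^ (n choose 2)) ^ j
      * (qpoch b q (Suc M + n) / (qpoch b q n * qpoch b q (Suc M)))" for n
  proof -
    have "coeff R n = (1 - c * q ^ n) / (1 - c) * coeff (root_prod x N) n"
    proof -
      have "coeff R n = (coeff (root_prod x N) n - c * (q ^ n * coeff (root_prod x N) n)) / (1 - c)"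
        by (simp add: R_def coeff_pcompose_linear)
      then show ?thesis by (simp add: algebra_simps)
    qed
    moreover have "qpoch b q (Suc M + n) = qpoch b q (M + n) * (1 - c * q ^ n)"
      by (simp add: qpoch_Suc c_def power_add mult_ac)
    moreover have "qpoch b q (Suc M) = qpoch b q M * (1 - c)"
      by (simp add: qpoch_Suc c_def)
    ultimately show ?thesis by (simp add: x(2) mult_ac)
  qed
  then show ?case using y by auto
qed

lemma qpoch_add: "qpoch b q (M + n) = qpoch b q M * (\<Prod>k<n. 1 - b * q ^ (M + k))"
  by (induction n) (simp_all add: qpoch_Suc)

text \<open>The coefficients of \<open>A\<close>, where \<open>g z = z * A (z\<^sup>2)\<close>; the parameters are
  \<open>j = 2\<close>, \<open>\<mu> = b / 4\<close> for Jackson's second and \<open>j = 1\<close>, \<open>\<mu> = q\<close> for his third function.\<close>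
definition q_coeff :: "nat \<Rightarrow> real \<Rightarrow> real \<Rightarrow> real \<Rightarrow> nat \<Rightarrow> real" where
  "q_coeff j q b \<mu> n = (- 1) ^ n * \<mu> ^ n * (q ^ (n choose 2)) ^ j / (qpoch q q n * qpoch b q n)"

lemma root_prod_dilation: "root_prod x N \<circ>\<^sub>p [:0, \<mu>:] = root_prod (\<lambda>i. x i / \<mu>) N"
  by (simp add: root_prod_def pcompose_prod pcompose_pCons)

text \<open>The degree and the number of dilation steps are both set to \<open>N\<close>, so a
  single limit suffices. The factor \<open>2 * real n + 1\<close> comes from
  \<open>root_prod_add_deriv\<close>, the factor \<open>\<mu> ^ n\<close> from a rescaling of the
  zeros.\<close>

lemma q_coeff_approx:
  assumes q: "0 < q" "q < 1" and b: "0 \<le> b" "b < 1" and j: "j \<in> {1, 2}" and "0 < \<mu>"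
  shows "\<exists>u. (\<forall>i<N. 0 < u i) \<and> (\<forall>n. coeff (root_prod u N) n
    = (2 * real n + 1) * ((- 1) ^ n * \<mu> ^ n * (q ^ (n choose 2)) ^ j
      * (gauss_binom q N n * ((\<Prod>k<n. 1 - b * q ^ (N + k)) / qpoch b q n))))"
proof -
  obtain x where x: "q_separated q x N"
    "\<And>n. coeff (root_prod x N) n = (- 1) ^ n * gauss_binom q N n * (q ^ (n choose 2)) ^ j
      * (qpoch b q (N + n) / (qpoch b q n * qpoch b q N))"
    using q_separated_gauss_binom_qpoch[OF q b j, of N N] by auto
  obtain u where u: "\<And>i. i < N \<Longrightarrow> 0 < u i"
    "root_prod x N + smult 2 (pCons 0 (pderiv (root_prod x N))) = root_prod u N"
    using root_prod_add_deriv[OF q(2) x(1)] by auto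
  have *: "coeff (root_prod u N) n = (2 * real n + 1) * coeff (root_prod x N) n" for n
    unfolding u(2)[symmetric]
    by (cases n) (simp_all add: coeff_pderiv algebra_simps)
  have "qpoch b q N \<noteq> 0" using qpoch_pos[OF q b(2), of N] by simp
  then have **: "qpoch b q (N + n) / (qpoch b q n * qpoch b q N)
      = (\<Prod>k<n. 1 - b * q ^ (N + k)) / qpoch b q n" for n
    by (simp add: qpoch_add)
  have "coeff (root_prod (\<lambda>i. u i / \<mu>) N) n
    = (2 * real n + 1) * ((- 1) ^ n * \<mu> ^ n * (q ^ (n choose 2)) ^ j
      * (gauss_binom q N n * ((\<Prod>k<n. 1 - b * q ^ (N + k)) / qpoch b q n)))" for n
    unfolding root_prod_dilation[symmetric] coeff_pcompose_linear * x(2) **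
    by (simp only: mult_ac)
  then show ?thesis using u(1) \<open>0 < \<mu>\<close> by (intro exI[of _ "\<lambda>i. u i / \<mu>"]) auto
qed

section \<open>Growth of the coefficients\<close>

lemma qpoch_ge:
  assumes "0 < q" "q < 1" "0 \<le> b" "b < 1"
  shows "(1 - b) ^ n \<le> qpoch b q n"
proof -
  have "(\<Prod>k<n. 1 - b) \<le> (\<Prod>k<n. 1 - b * q ^ k)"
    using assms by (intro prod_mono) (auto simp: mult_left_le power_le_one)
  then show ?thesis by (simp add: qpoch_def)
qed

text \<open>Consecutive terms have the ratio \<open>q ^ n * C\<close>, which tends to 0.\<close>

lemma summable_power_choose_two:
  fixes q :: real
  assumes "0 < q" "q < 1" "0 \<le> C"
  shows "summable (\<lambda>n. q ^ (n choose 2) * C ^ n)"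
proof -
  have "(\<lambda>n. q ^ n * C) \<longlonglongrightarrow> 0 * C"
    using assms by (intro tendsto_intros LIMSEQ_realpow_zero) auto
  then have "eventually (\<lambda>n. q ^ n * C < 1 / 2) sequentially"
    by (rule order_tendstoD) simp
  then obtain m where m: "\<And>n. m \<le> n \<Longrightarrow> q ^ n * C < 1 / 2"
    by (auto simp: eventually_sequentially)
  show ?thesis
  proof (rule summable_ratio_test[where c = "1 / 2" and N = m])
    fix n assume "m \<le> n"
    then have "q ^ n * C * (q ^ (n choose 2) * C ^ n) \<le> 1 / 2 * (q ^ (n choose 2) * C ^ n)"
      using m[of n] assms by (intro mult_right_mono) auto
    then show "norm (q ^ (Suc n choose 2) * C ^ Suc n) \<le> 1 / 2 * norm (q ^ (n choose 2) * C ^ n)"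
      using assms by (simp add: Suc_choose_two power_add mult_ac)
  qed simp
qed

lemma q_coeff_summable:
  assumes q: "0 < q" "q < 1" and b: "0 \<le> b" "b < 1" and j: "j \<in> {1, 2}" and "0 < \<mu>"
  shows "summable (\<lambda>n. \<bar>(2 * real n + 1) * q_coeff j q b \<mu> n\<bar> * R ^ n)"
proof (rule summable_comparison_test')
  \<comment> \<open>The 4 absorbs \<open>2 * real n + 1\<close>, and the denominators are the lower
    bounds of \<open>qpoch_ge\<close>. One factor \<open>q ^ (n choose 2)\<close> is kept for both
    values of \<open>j\<close>.\<close>
  define C where "C = 4 * (\<mu> * \<bar>R\<bar> / ((1 - q) * (1 - b)))"
  show "summable (\<lambda>n. q ^ (n choose 2) * C ^ n)"
    using q b \<open>0 < \<mu>\<close> by (intro summable_power_choose_two) (auto simp: C_def)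
  show "norm (\<bar>(2 * real n + 1) * q_coeff j q b \<mu> n\<bar> * R ^ n) \<le> q ^ (n choose 2) * C ^ n"
    if "0 \<le> n" for n
  proof -
    have "(2 * real n + 1) \<le> 4 ^ n"
      by (induction n) auto
    moreover have "(q ^ (n choose 2)) ^ j \<le> q ^ (n choose 2)"
    proof -
      have "q ^ (n choose 2) * q ^ (n choose 2) \<le> q ^ (n choose 2) * 1"
        using q by (intro mult_left_mono power_le_one) auto
      then show ?thesis using j by (auto simp: power2_eq_square)
    qed
    moreover have "\<mu> ^ n * \<bar>R\<bar> ^ n / (qpoch q q n * qpoch b q n)
        \<le> \<mu> ^ n * \<bar>R\<bar> ^ n / ((1 - q) ^ n * (1 - b) ^ n)"
      using q b \<open>0 < \<mu>\<close> qpoch_ge[OF q, of q n] qpoch_ge[OF q b, of n]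
        qpoch_pos[OF q q(2), of n, THEN less_imp_le]
      by (intro divide_left_mono mult_mono mult_pos_pos qpoch_pos) auto
    ultimately have "((2 * real n + 1) * (q ^ (n choose 2)) ^ j)
          * (\<mu> ^ n * \<bar>R\<bar> ^ n / (qpoch q q n * qpoch b q n))
        \<le> (4 ^ n * q ^ (n choose 2)) * (\<mu> ^ n * \<bar>R\<bar> ^ n / ((1 - q) ^ n * (1 - b) ^ n))"
      using q b \<open>0 < \<mu>\<close> qpoch_pos[OF q q(2), of n] qpoch_pos[OF q b(2), of n]
      by (intro mult_mono) auto
    also have "\<dots> = q ^ (n choose 2) * C ^ n"
      by (simp add: C_def power_mult_distrib power_divide)
    also have "((2 * real n + 1) * (q ^ (n choose 2)) ^ j)
          * (\<mu> ^ n * \<bar>R\<bar> ^ n / (qpoch q q n * qpoch b q n))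
        = norm (\<bar>(2 * real n + 1) * q_coeff j q b \<mu> n\<bar> * R ^ n)"
      using q b \<open>0 < \<mu>\<close> qpoch_pos[OF q q(2), of n] qpoch_pos[OF q b(2), of n]
      by (simp add: q_coeff_def abs_mult power_abs)
    finally show ?thesis .
  qed
qed

subsection \<open>Limits of polynomials with positive zeros\<close>

definition entire_coeffs :: "(nat \<Rightarrow> real) \<Rightarrow> bool" where
  "entire_coeffs a \<longleftrightarrow> (\<forall>R. summable (\<lambda>n. \<bar>a n\<bar> * R ^ n))"

text \<open>The argument ranges over any complete normed field, so that estimates on the real axis
  and in the complex disc concern the same series.\<close>

definition pseries :: "(nat \<Rightarrow> real) \<Rightarrow> 'a \<Rightarrow> 'a::{real_normed_field,banach}" where
  "pseries a w = (\<Sum>n. of_real (a n) * w ^ n)"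

lemma entire_coeffs_summable_norm:
  fixes w :: "'a::{real_normed_field,banach}"
  assumes "entire_coeffs a"
  shows "summable (\<lambda>n. norm (of_real (a n) * w ^ n))"
  using assms by (simp add: entire_coeffs_def norm_mult norm_power)

lemma entire_coeffs_summable:
  fixes w :: "'a::{real_normed_field,banach}"
  assumes "entire_coeffs a"
  shows "summable (\<lambda>n. of_real (a n) * w ^ n)"
  using entire_coeffs_summable_norm[OF assms] by (rule summable_norm_cancel)

lemma entire_coeffs_mono:
  assumes "entire_coeffs b" "\<And>n. \<bar>a n\<bar> \<le> \<bar>b n\<bar>"
  shows "entire_coeffs a"
  unfolding entire_coeffs_def
proof
  fix R :: real
  show "summable (\<lambda>n. \<bar>a n\<bar> * R ^ n)"
  proof (rule summable_comparison_test')
    show "summable (\<lambda>n. \<bar>b n\<bar> * \<bar>R\<bar> ^ n)" using assms(1) by (simp add: entire_coeffs_def)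
    show "norm (\<bar>a n\<bar> * R ^ n) \<le> \<bar>b n\<bar> * \<bar>R\<bar> ^ n" for n
      using assms(2)[of n] by (simp add: abs_mult power_abs mult_right_mono)
  qed
qed

lemma entire_coeffs_diffs:
  assumes "entire_coeffs a"
  shows "entire_coeffs (diffs a)"
proof -
  have "summable (\<lambda>n. diffs (\<lambda>n. \<bar>a n\<bar>) n * R ^ n)" for R
    using assms by (intro termdiff_converges_all) (auto simp: entire_coeffs_def)
  moreover have "diffs (\<lambda>n. \<bar>a n\<bar>) = (\<lambda>n. \<bar>diffs a n\<bar>)"
    by (simp add: diffs_def abs_mult fun_eq_iff)
  ultimately show ?thesis by (simp add: entire_coeffs_def)
qed

lemma has_field_derivative_pseries:
  assumes "entire_coeffs a"
  shows "(pseries a has_field_derivative pseries (diffs a) w) (at w)"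
proof -
  have "diffs (\<lambda>n. of_real (a n) :: 'a) = (\<lambda>n. of_real (diffs a n))"
    by (simp add: diffs_def fun_eq_iff)
  then show ?thesis
    unfolding pseries_def
    using termdiffs_strong_converges_everywhere[OF entire_coeffs_summable[OF assms], of w] by simp
qed

lemma continuous_on_pseries:
  assumes "entire_coeffs a"
  shows "continuous_on S (pseries a)"
  using DERIV_isCont[OF has_field_derivative_pseries[OF assms]]
  by (intro continuous_at_imp_continuous_on) blast

lemma pseries_of_real:
  assumes "entire_coeffs a"
  shows "pseries a (of_real x) = of_real (pseries a x)"
proof -
  have "(of_real (pseries a x) :: 'a) = (\<Sum>n. of_real (a n * x ^ n))"
    unfolding pseries_def using entire_coeffs_summable[OF assms, of x]
    by (subst suminf_of_real) auto
  then show ?thesis by (simp add: pseries_def)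
qed

lemma pseries_0 [simp]: "pseries a 0 = of_real (a 0)"
  unfolding pseries_def by (simp add: powser_zero)

lemma pseries_coeff: "pseries (coeff p) w = poly (map_poly of_real p) w"
proof -
  have "pseries (coeff p) w = (\<Sum>n\<le>degree p. of_real (coeff p n) * w ^ n)"
    unfolding pseries_def by (rule suminf_finite) (auto simp: coeff_eq_0)
  also have "\<dots> = poly (map_poly of_real p) w"
    by (simp add: poly_altdef coeff_map_poly degree_map_poly)
  finally show ?thesis .
qed

lemma entire_coeffs_coeff: "entire_coeffs (coeff p)"
proof -
  have "summable (\<lambda>n. \<bar>coeff p n\<bar> * R ^ n)" for R
    by (rule summable_finite[of "{..degree p}"]) (auto simp: coeff_eq_0)
  then show ?thesis by (simp add: entire_coeffs_def)
qed

lemma pseries_coeff_root_prod: "pseries (coeff (root_prod x N)) w = (\<Prod>i<N. 1 - w / of_real (x i))"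
proof -
  have "poly (map_poly of_real (root_prod x N)) w = (\<Prod>i<N. 1 - w / of_real (x i))"
  proof (induction N)
    case 0
    then show ?case by (simp add: root_prod_def)
  next
    case (Suc N)
    define c where "c = - 1 / x N"
    have "root_prod x (Suc N) = root_prod x N * [:1, c:]"
      by (simp add: root_prod_def c_def)
    moreover have "map_poly of_real (root_prod x N * [:1, c:]) =
        (map_poly of_real (root_prod x N) * [:1, of_real c:] :: 'a poly)"
      by (rule poly_eqI) (auto simp: coeff_map_poly coeff_pCons split: nat.split)
    ultimately show ?case by (simp add: Suc.IH c_def algebra_simps)
  qed
  then show ?thesis by (simp add: pseries_coeff)
qed

text \<open>Each factor satisfies \<open>1 - \<rho> / u i \<le> norm (1 - w / u i)\<close>, and each
  summand of the logarithmic derivative is largest in norm at \<open>w = \<rho>\<close>. The second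
  bound is stated without quotients, in a form that passes to limits.\<close>

lemma root_prod_norm_bounds:
  fixes w :: "'a::{real_normed_field,banach}"
  assumes u: "\<And>i. i < N \<Longrightarrow> \<rho> < u i" and w: "norm w \<le> \<rho>"
  defines "c \<equiv> coeff (root_prod u N)"
  shows "pseries c \<rho> \<le> norm (pseries c w)"
    and "norm (w * pseries (diffs c) w) * pseries c \<rho> \<le> - (\<rho> * pseries (diffs c) \<rho>) * norm (pseries c w)"
proof -
  have \<rho>: "0 \<le> \<rho>" using w norm_ge_zero[of w] by linarith
  have upos: "0 < u i" if "i < N" for i using u[OF that] \<rho> by simp
  then have u_nz: "u i \<noteq> 0" if "i < N" for i using that by force
  have fac: "1 - \<rho> / u i \<le> norm (1 - z / of_real (u i))" if "i < N" "norm z \<le> \<rho>" for z :: 'a and i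
  proof -
    have "norm (z / of_real (u i)) \<le> \<rho> / u i"
      using upos[OF that(1)] that(2) by (simp add: norm_divide divide_right_mono)
    then show ?thesis using norm_triangle_ineq2[of 1 "z / of_real (u i)"] by simp
  qed
  have pos: "0 < 1 - \<rho> / u i" if "i < N" for i using u[OF that] upos[OF that] by simp
  show 1: "pseries c \<rho> \<le> norm (pseries c w)"
    unfolding c_def pseries_coeff_root_prod prod_norm[symmetric]
    using fac[OF _ w] pos by (intro prod_mono) (auto intro: less_imp_le)
  have \<rho>pos: "0 < pseries c \<rho>"
    unfolding c_def pseries_coeff_root_prod using pos by (intro prod_pos) auto
  \<comment> \<open>The field \<open>'b\<close> is separate from \<open>'a\<close> because the
    formula is used both at the real point \<rho> and at \<open>w\<close>.\<close>
  have log_deriv: "pseries (diffs c) z = pseries c z * (\<Sum>i<N. (- 1 / of_real (u i)) / (1 - z / of_real (u i)))"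
    if "\<And>i. i < N \<Longrightarrow> 1 - z / of_real (u i) \<noteq> 0" for z :: "'b::{real_normed_field,banach}"
  proof -
    have "((\<lambda>z. \<Prod>i<N. 1 - z / of_real (u i)) has_field_derivative
       (\<Prod>i<N. 1 - z / of_real (u i)) * (\<Sum>i<N. (- 1 / of_real (u i)) / (1 - z / of_real (u i)))) (at z)"
      by (rule has_field_derivative_prod') (use that u_nz in \<open>auto intro!: derivative_eq_intros\<close>)
    moreover have "(\<lambda>z. \<Prod>i<N. 1 - z / of_real (u i)) = (pseries c :: 'b \<Rightarrow> 'b)"
      by (simp add: fun_eq_iff c_def pseries_coeff_root_prod)
    moreover have "(pseries c has_field_derivative pseries (diffs c) z) (at z)"
      unfolding c_def by (rule has_field_derivative_pseries[OF entire_coeffs_coeff])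
    ultimately show ?thesis
      using DERIV_unique by (simp add: c_def pseries_coeff_root_prod)
  qed
  define S where "S = (\<Sum>i<N. (\<rho> / u i) / (1 - \<rho> / u i))"
  have "- (\<rho> * pseries (diffs c) \<rho>) = pseries c \<rho> * S"
  proof -
    have D: "pseries (diffs c) \<rho> = pseries c \<rho> * (\<Sum>i<N. (- 1 / u i) / (1 - \<rho> / u i))"
      using log_deriv[of \<rho>] pos by (simp add: less_le)
    have T: "\<rho> * (\<Sum>i<N. (- 1 / u i) / (1 - \<rho> / u i)) = - S"
      unfolding S_def sum_distrib_left sum_negf[symmetric] by (intro sum.cong) auto
    have "\<rho> * pseries (diffs c) \<rho> = pseries c \<rho> * - S"
      unfolding D T[symmetric] by (rule mult.left_commute)
    then show ?thesis by simp
  qed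
  moreover have "norm (w * pseries (diffs c) w) \<le> norm (pseries c w) * S"
  proof -
    have "pseries (diffs c) w = pseries c w * (\<Sum>i<N. (- 1 / of_real (u i)) / (1 - w / of_real (u i)))"
    proof (rule log_deriv)
      show "1 - w / of_real (u i) \<noteq> 0" if "i < N" for i
        using fac[OF that w] pos[OF that] by auto
    qed
    then have "w * pseries (diffs c) w
        = pseries c w * (\<Sum>i<N. w * ((- 1 / of_real (u i)) / (1 - w / of_real (u i))))"
      by (simp add: sum_distrib_left mult_ac)
    moreover have "norm (\<Sum>i<N. w * ((- 1 / of_real (u i)) / (1 - w / of_real (u i)))) \<le> S"
      unfolding S_def
    proof (rule sum_norm_le)
      fix i assume "i \<in> {..<N}"
      then have i: "i < N" by simp
      have "norm (w * ((- 1 / of_real (u i)) / (1 - w / of_real (u i))))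
          = (norm w / u i) / norm (1 - w / of_real (u i))"
        using upos[OF i] by (simp add: norm_mult norm_divide)
      also have "\<dots> \<le> (\<rho> / u i) / (1 - \<rho> / u i)"
        using fac[OF i w] pos[OF i] upos[OF i] w \<rho> by (intro frac_le divide_right_mono) auto
      finally show "norm (w * ((- 1 / of_real (u i)) / (1 - w / of_real (u i))))
          \<le> (\<rho> / u i) / (1 - \<rho> / u i)" .
    qed
    ultimately show ?thesis by (simp add: norm_mult mult_left_mono)
  qed
  then have "norm (w * pseries (diffs c) w) * pseries c \<rho> \<le> norm (pseries c w) * S * pseries c \<rho>"
    using \<rho>pos by (intro mult_right_mono) auto
  ultimately show "norm (w * pseries (diffs c) w) * pseries c \<rho>
      \<le> - (\<rho> * pseries (diffs c) \<rho>) * norm (pseries c w)"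
    by (simp add: mult_ac)
qed

text \<open>Tannery's theorem: the common majorant upgrades convergence of each coefficient to
  convergence of the values.\<close>

lemma pseries_tendsto:
  fixes w :: "'a::{real_normed_field,banach}"
  assumes "entire_coeffs b" "\<And>N n. \<bar>a N n\<bar> \<le> \<bar>b n\<bar>" "\<And>n. (\<lambda>N. a N n) \<longlonglongrightarrow> e n"
  shows "(\<lambda>N. pseries (a N) w) \<longlonglongrightarrow> pseries e w"
proof -
  have "eventually (\<lambda>N. summable (\<lambda>n. norm (of_real (a N n) * w ^ n))) sequentially \<and>
      summable (\<lambda>n. norm (of_real (e n) * w ^ n)) \<and>
      ((\<lambda>N. \<Sum>n. of_real (a N n) * w ^ n) \<longlongrightarrow> (\<Sum>n. of_real (e n) * w ^ n)) sequentially"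
  proof (rule tannerys_theorem)
    show "((\<lambda>N. of_real (a N n) * w ^ n) \<longlongrightarrow> of_real (e n) * w ^ n) sequentially" for n
      by (intro tendsto_intros assms)
    show "summable (\<lambda>n. \<bar>b n\<bar> * norm w ^ n)" using assms(1) by (simp add: entire_coeffs_def)
    show "\<forall>\<^sub>F (n, N) in at_top \<times>\<^sub>F sequentially. norm (of_real (a N n) * w ^ n) \<le> \<bar>b n\<bar> * norm w ^ n"
      by (rule always_eventually) (auto simp: norm_mult norm_power assms(2) mult_right_mono)
  qed simp
  then show ?thesis by (simp add: pseries_def)
qed

text \<open>Entire functions of genus zero with positive zeros, presented as limits of polynomials
  with positive zeros; this replaces Hadamard factorisation.\<close>
locale pos_root_limit =
  fixes e :: "nat \<Rightarrow> real" and u :: "nat \<Rightarrow> nat \<Rightarrow> real"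
  assumes entire: "entire_coeffs e"
    and u_pos: "\<And>N i. i < N \<Longrightarrow> 0 < u N i"
    and coeff_le: "\<And>N n. \<bar>coeff (root_prod (u N) N) n\<bar> \<le> \<bar>e n\<bar>"
    and coeff_tendsto: "\<And>n. (\<lambda>N. coeff (root_prod (u N) N) n) \<longlonglongrightarrow> e n"
    and e_1: "e 1 \<noteq> 0"
begin

definition approx :: "nat \<Rightarrow> nat \<Rightarrow> real" where "approx N = coeff (root_prod (u N) N)"

lemma e_0: "e 0 = 1"
proof -
  have "coeff (root_prod (u N) N) 0 = 1" for N
    using poly_root_prod[of "u N" N 0] by (simp add: poly_0_coeff_0)
  then show ?thesis using coeff_tendsto[of 0] LIMSEQ_const_iff[of 1 "e 0"] by simp
qed

lemma pseries_approx_tendsto: "(\<lambda>N. pseries (approx N) w) \<longlonglongrightarrow> pseries e w"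
  using pseries_tendsto[OF entire coeff_le coeff_tendsto] by (simp add: approx_def)

lemma pseries_diffs_approx_tendsto: "(\<lambda>N. pseries (diffs (approx N)) w) \<longlonglongrightarrow> pseries (diffs e) w"
proof (rule pseries_tendsto[OF entire_coeffs_diffs[OF entire]])
  show "\<bar>diffs (approx N) n\<bar> \<le> \<bar>diffs e n\<bar>" for N n
    using coeff_le[of N "Suc n"] by (simp add: approx_def diffs_def abs_mult mult_left_mono)
  show "(\<lambda>N. diffs (approx N) n) \<longlonglongrightarrow> diffs e n" for n
    unfolding approx_def diffs_def by (intro tendsto_intros coeff_tendsto)
qed

text \<open>A one-sided Hurwitz argument on the real axis. On \<open>{0..\<rho>}\<close> the limit
  has a positive minimum, while it exceeds an approximation by at most the sum of
  \<open>\<bar>approx N n - e n\<bar> * \<rho> ^ n\<close>, which tends to 0; at a zero of the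
  approximation these two facts collide.\<close>

lemma eventually_roots_gt:
  assumes pos: "\<And>t. 0 \<le> t \<Longrightarrow> t \<le> \<rho> \<Longrightarrow> 0 < pseries e (t::real)" and "0 \<le> \<rho>"
  shows "\<forall>\<^sub>F N in sequentially. \<forall>i<N. \<rho> < u N i"
proof -
  have "\<exists>t\<in>{0..\<rho>}. \<forall>s\<in>{0..\<rho>}. pseries e t \<le> pseries e s"
    using \<open>0 \<le> \<rho>\<close> by (intro continuous_attains_inf continuous_on_pseries[OF entire]) auto
  then obtain t0 where t0: "t0 \<in> {0..\<rho>}" "\<And>t. t \<in> {0..\<rho>} \<Longrightarrow> pseries e t0 \<le> pseries e t"
    by blast
  define m where "m = pseries e t0"
  have "0 < m" unfolding m_def using t0 pos by auto
  define d where "d = (\<lambda>N n. \<bar>approx N n - e n\<bar>)"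
  have d_le: "\<bar>d N n\<bar> \<le> \<bar>2 * e n\<bar>" for N n
    using coeff_le[of N n] by (simp add: d_def approx_def abs_mult)
  have ent2: "entire_coeffs (\<lambda>n. 2 * e n)"
    using entire unfolding entire_coeffs_def by (simp add: abs_mult mult.assoc summable_mult)
  have "(\<lambda>N. pseries (d N) \<rho>) \<longlonglongrightarrow> pseries (\<lambda>n. \<bar>e n - e n\<bar>) \<rho>"
    by (rule pseries_tendsto[OF ent2 d_le])
      (unfold d_def approx_def, intro tendsto_intros coeff_tendsto)
  then have "(\<lambda>N. pseries (d N) \<rho>) \<longlonglongrightarrow> 0" by (simp add: pseries_def)
  then have "\<forall>\<^sub>F N in sequentially. pseries (d N) \<rho> < m"
    using \<open>0 < m\<close> by (rule order_tendstoD)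
  then show ?thesis
  proof eventually_elim
    case (elim N)
    have ed: "entire_coeffs (d N)" by (rule entire_coeffs_mono[OF ent2 d_le])
    have ec: "entire_coeffs (approx N)" unfolding approx_def by (rule entire_coeffs_coeff)
    show ?case
    proof (intro allI impI)
      fix i assume i: "i < N"
      show "\<rho> < u N i"
      proof (rule ccontr)
        assume "\<not> \<rho> < u N i"
        then have t: "0 < u N i" "u N i \<le> \<rho>" using u_pos[OF i] by auto
        have "pseries (approx N) (u N i) = 0"
          unfolding approx_def pseries_coeff_root_prod using i t by (intro prod_zero bexI[of _ i]) auto
        then have "pseries e (u N i) = (\<Sum>n. (e n - approx N n) * u N i ^ n)"
          using suminf_diff[OF entire_coeffs_summable[OF entire, of "u N i"]
              entire_coeffs_summable[OF ec, of "u N i"]]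
          by (simp add: pseries_def algebra_simps)
        also have "\<dots> \<le> pseries (d N) \<rho>"
          unfolding pseries_def
        proof (rule suminf_le)
          show "summable (\<lambda>n. (e n - approx N n) * u N i ^ n)"
            using summable_diff[OF entire_coeffs_summable[OF entire, of "u N i"]
              entire_coeffs_summable[OF ec, of "u N i"]] by (simp add: algebra_simps)
          show "summable (\<lambda>n. of_real (d N n) * \<rho> ^ n)"
            by (rule entire_coeffs_summable[OF ed])
          show "(e n - approx N n) * u N i ^ n \<le> of_real (d N n) * \<rho> ^ n" for n
          proof -
            have "u N i ^ n \<le> \<rho> ^ n" using t by (intro power_mono) auto
            moreover have "e n - approx N n \<le> d N n" "0 \<le> d N n" by (auto simp: d_def)
            ultimately show ?thesis using t by (simp add: mult_mono)
          qed
        qed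
        finally show False using elim t0(2)[of "u N i"] t by (simp add: m_def)
      qed
    qed
  qed
qed

text \<open>For large \<open>N\<close> all zeros exceed \<rho>, so
  \<open>root_prod_norm_bounds\<close> applies to the approximations, and its weak inequalities
  survive the limit.\<close>

lemma norm_bounds:
  fixes w :: "'a::{real_normed_field,banach}"
  assumes pos: "\<And>t. 0 \<le> t \<Longrightarrow> t \<le> \<rho> \<Longrightarrow> 0 < pseries e (t::real)" and w: "norm w \<le> \<rho>"
  shows "pseries e \<rho> \<le> norm (pseries e w)"
    and "norm (w * pseries (diffs e) w) * pseries e \<rho> \<le> - (\<rho> * pseries (diffs e) \<rho>) * norm (pseries e w)"
proof -
  have "0 \<le> \<rho>" using w norm_ge_zero[of w] by linarith
  then have ev: "\<forall>\<^sub>F N in sequentially. \<forall>i<N. \<rho> < u N i"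
    using pos by (intro eventually_roots_gt) auto
  show "pseries e \<rho> \<le> norm (pseries e w)"
  proof (rule tendsto_le)
    show "(\<lambda>N. pseries (approx N) \<rho>) \<longlonglongrightarrow> pseries e \<rho>" by (rule pseries_approx_tendsto)
    show "(\<lambda>N. norm (pseries (approx N) w)) \<longlonglongrightarrow> norm (pseries e w)"
      by (intro tendsto_norm pseries_approx_tendsto)
    show "\<forall>\<^sub>F N in sequentially. pseries (approx N) \<rho> \<le> norm (pseries (approx N) w)"
      using ev by eventually_elim (use root_prod_norm_bounds(1)[OF _ w] in \<open>auto simp: approx_def\<close>)
  qed simp
  show "norm (w * pseries (diffs e) w) * pseries e \<rho> \<le> - (\<rho> * pseries (diffs e) \<rho>) * norm (pseries e w)"
  proof (rule tendsto_le)
    show "(\<lambda>N. norm (w * pseries (diffs (approx N)) w) * pseries (approx N) \<rho>)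
        \<longlonglongrightarrow> norm (w * pseries (diffs e) w) * pseries e \<rho>"
      by (intro tendsto_intros pseries_approx_tendsto pseries_diffs_approx_tendsto)
    show "(\<lambda>N. - (\<rho> * pseries (diffs (approx N)) \<rho>) * norm (pseries (approx N) w))
        \<longlonglongrightarrow> - (\<rho> * pseries (diffs e) \<rho>) * norm (pseries e w)"
      by (intro tendsto_intros pseries_approx_tendsto pseries_diffs_approx_tendsto)
    show "\<forall>\<^sub>F N in sequentially. norm (w * pseries (diffs (approx N)) w) * pseries (approx N) \<rho>
        \<le> - (\<rho> * pseries (diffs (approx N)) \<rho>) * norm (pseries (approx N) w)"
      using ev by eventually_elim (use root_prod_norm_bounds(2)[OF _ w] in \<open>auto simp: approx_def\<close>)
  qed simp
qed

section \<open>The function \<open>H\<close> and its first positive zero\<close>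

text \<open>Where \<open>pseries e t\<close> is positive, \<open>0 < H t\<close> means that the real
  quantity t E'(t) / E(t) exceeds -1/4; this is the threshold for uniform convexity on the positive
  axis.\<close>

definition H :: "real \<Rightarrow> real" where
  "H t = pseries e t + 4 * t * pseries (diffs e) t"

lemma H_0: "H 0 = 1"
  by (simp add: H_def e_0)

lemma continuous_on_H: "continuous_on S H"
  unfolding H_def
  by (intro continuous_intros continuous_on_pseries entire_coeffs_diffs entire)

text \<open>\<open>H (t^4)\<close> is the derivative of \<open>t * pseries e (t^4)\<close>.\<close>
lemma pseries_pos_of_H_pos:
  assumes H: "\<And>t. 0 \<le> t \<Longrightarrow> t < \<rho> \<Longrightarrow> 0 < H t" and t: "0 \<le> t" "t \<le> \<rho>"
  shows "0 < pseries e t"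
proof (cases "t = 0")
  case True
  then show ?thesis by (simp add: e_0)
next
  case False
  define r where "r = root 4 t"
  have r: "0 < r" "r ^ 4 = t" using False t by (auto simp: r_def)
  define f where "f = (\<lambda>x. x * pseries e (x ^ 4 :: real))"
  have "((\<lambda>x. pseries e (x ^ 4)) has_field_derivative pseries (diffs e) (x ^ 4) * (4 * x ^ 3)) (at x)"
    for x :: real
    by (rule DERIV_chain2[OF has_field_derivative_pseries[OF entire]])
      (auto intro!: derivative_eq_intros)
  then have der: "(f has_field_derivative H (x ^ 4)) (at x)" for x
    unfolding f_def H_def
    by (auto intro!: derivative_eq_intros simp: power_numeral_reduce algebra_simps)
  \<comment> \<open>Only the open interval has to have positive derivative, so the conclusion
    includes \<open>t = \<rho>\<close>; this is used at the first zero of \<open>H\<close>.\<close>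
  have "f 0 < f r"
  proof (rule DERIV_pos_imp_increasing_open[OF r(1)])
    fix x :: real assume x: "0 < x" "x < r"
    then have "x ^ 4 < r ^ 4" by (intro power_strict_mono) auto
    then have "0 < H (x ^ 4)" using H[of "x ^ 4"] x r t by auto
    then show "\<exists>y. (f has_real_derivative y) (at x) \<and> 0 < y" using der by blast
  next
    show "continuous_on {0..r} f"
      by (intro continuous_at_imp_continuous_on ballI DERIV_isCont[OF der])
  qed
  then show ?thesis using r by (auto simp: f_def zero_less_mult_iff)
qed

text \<open>\<open>norm_bounds\<close> with radius \<open>norm w\<close> reduces the claim to the
  positive real point \<open>norm w\<close>, where it is the inequality
  \<open>0 < H (norm w)\<close>.\<close>

lemma norm_log_deriv_less:
  fixes w :: "'a::{real_normed_field,banach}"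
  assumes H: "\<And>t. 0 \<le> t \<Longrightarrow> t < \<rho> \<Longrightarrow> 0 < H t" and w: "norm w < \<rho>"
  shows "pseries e w \<noteq> 0 \<and> norm (w * pseries (diffs e) w / pseries e w) < 1 / 4"
proof -
  have pos: "0 < pseries e t" if "0 \<le> t" "t \<le> norm w" for t :: real
    using pseries_pos_of_H_pos[OF H, of t] that w by auto
  have E: "0 < pseries e (norm w)" using pos by auto
  moreover have "pseries e (norm w) \<le> norm (pseries e w)"
    by (rule norm_bounds(1)) (use pos in auto)
  ultimately have Ew: "0 < norm (pseries e w)" by linarith
  have le: "norm (w * pseries (diffs e) w) * pseries e (norm w)
      \<le> - (norm w * pseries (diffs e) (norm w)) * norm (pseries e w)"
    by (rule norm_bounds(2)) (use pos in auto)
  have "- (norm w * pseries (diffs e) (norm w)) < pseries e (norm w) / 4"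
    using H[of "norm w"] w by (simp add: H_def field_simps)
  then have "- (norm w * pseries (diffs e) (norm w)) * norm (pseries e w)
      < pseries e (norm w) / 4 * norm (pseries e w)"
    using Ew by (intro mult_strict_right_mono)
  then have "norm (w * pseries (diffs e) w) * pseries e (norm w)
      < (norm (pseries e w) / 4) * pseries e (norm w)"
    using le by (simp add: mult_ac)
  then have "norm (w * pseries (diffs e) w) < norm (pseries e w) / 4"
    using E by (simp only: mult_less_cancel_right_pos)
  then show ?thesis using Ew by (simp add: norm_divide field_simps)
qed

text \<open>Without a positive zero of \<open>H\<close>, \<open>w E'(w) / E(w)\<close> would be a bounded entire function.\<close>
lemma H_has_root: "\<exists>t>0. H t = 0"
proof (rule ccontr)
  assume nz: "\<not> (\<exists>t>0. H t = 0)"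
  have Hpos: "0 < H t" if "0 \<le> t" for t
  proof (rule ccontr)
    assume "\<not> 0 < H t"
    then have "\<exists>x\<ge>0. x \<le> t \<and> H x = 0"
      using that by (intro IVT2') (auto simp: H_0 continuous_on_H)
    then show False using nz H_0 by (metis less_eq_real_def zero_neq_one)
  qed
  have bound: "pseries e w \<noteq> 0 \<and> norm (w * pseries (diffs e) w / pseries e w) < 1 / 4" for w :: complex
    by (rule norm_log_deriv_less[where \<rho> = "norm w + 1"]) (auto intro: Hpos)
  define F where "F = (\<lambda>w::complex. w * pseries (diffs e) w / pseries e w)"
  have "(pseries a :: complex \<Rightarrow> complex) holomorphic_on UNIV" if "entire_coeffs a" for a
    using has_field_derivative_pseries[OF that]
    by (auto simp: holomorphic_on_def field_differentiable_def)
  then have "F holomorphic_on UNIV"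
    unfolding F_def using bound entire entire_coeffs_diffs[OF entire]
    by (intro holomorphic_intros) auto
  moreover have "bounded (range F)"
    using bound by (auto simp: bounded_iff F_def intro!: exI[of _ "1 / 4"] less_imp_le)
  ultimately have "F constant_on UNIV" by (rule Liouville_theorem)
  \<comment> \<open>The constant is \<open>F 0 = 0\<close>. Hence E' vanishes away from 0, by
    continuity also at 0, and E'(0) = \<open>e 1\<close> contradicts \<open>e_1\<close>.\<close>
  then have F0: "F w = 0" for w
    by (metis F_def UNIV_I constant_on_def div_0 mult_zero_left)
  have zero: "pseries (diffs e) w = 0" if "w \<noteq> 0" for w :: complex
    using F0[of w] bound[of w] that by (simp add: F_def)
  have lim: "pseries (diffs e) \<midarrow>0\<rightarrow> pseries (diffs e) (0::complex)"
    using DERIV_isCont[OF has_field_derivative_pseries[OF entire_coeffs_diffs[OF entire]]]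
    unfolding isCont_def .
  have "((\<lambda>_::complex. 0) \<longlongrightarrow> pseries (diffs e) (0::complex)) (at 0)"
    by (rule Lim_transform_eventually[OF lim]) (auto simp: eventually_at_filter zero)
  then have "pseries (diffs e) (0::complex) = 0"
    using tendsto_unique[of "at (0::complex)"] tendsto_const by (metis trivial_limit_at)
  then show False using e_1 by (simp add: diffs_def)
qed

text \<open>The zeros of \<open>H\<close> in \<open>{0..}\<close> form a closed set, so the infimum
  is attained; it is not 0 because \<open>H 0 = 1\<close>. A nonpositive value earlier would yield
  an earlier zero.\<close>

lemma first_root_H:
  obtains w0 where "0 < w0" "H w0 = 0" "\<And>t. 0 \<le> t \<Longrightarrow> t < w0 \<Longrightarrow> 0 < H t"
proof -
  define Z where "Z = {0..} \<inter> H -` {0}"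
  have "closed Z"
    unfolding Z_def by (rule continuous_closed_preimage[OF continuous_on_H]) auto
  moreover have "Z \<noteq> {}" using H_has_root by (auto simp: Z_def intro: less_imp_le)
  moreover have "bdd_below Z" by (auto simp: Z_def intro: bdd_belowI[of _ 0])
  ultimately have I: "Inf Z \<in> Z" by (intro closed_contains_Inf)
  have "Inf Z \<noteq> 0" using I H_0 by (auto simp: Z_def)
  then have "0 < Inf Z" "H (Inf Z) = 0" using I by (auto simp: Z_def)
  moreover have "0 < H t" if "0 \<le> t" "t < Inf Z" for t
  proof (rule ccontr)
    assume "\<not> 0 < H t"
    then have "\<exists>x\<ge>0. x \<le> t \<and> H x = 0"
      using that by (intro IVT2') (auto simp: H_0 continuous_on_H)
    then obtain x where "x \<in> Z" "x \<le> t" by (auto simp: Z_def)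
    then show False using cInf_lower[OF _ \<open>bdd_below Z\<close>] that by fastforce
  qed
  ultimately show ?thesis using that by blast
qed

end

subsection \<open>The radius of uniform convexity\<close>

lemma pseries_of_nat_mult:
  assumes "entire_coeffs a"
  shows "pseries (\<lambda>n. real n * a n) w = w * pseries (diffs a) w"
proof -
  have d: "diffs (\<lambda>n. of_real (a n) :: 'a) = (\<lambda>n. of_real (diffs a n))"
    by (simp add: diffs_def fun_eq_iff)
  have "(\<lambda>n. of_nat n * of_real (a n) * w ^ (n - Suc 0)) sums pseries (diffs a) w"
    using diffs_equiv[of "\<lambda>n. of_real (a n)" w]
      entire_coeffs_summable[OF entire_coeffs_diffs[OF assms], of w]
    by (simp add: d pseries_def)
  then have "(\<lambda>n. w * (of_nat n * of_real (a n) * w ^ (n - Suc 0))) sums (w * pseries (diffs a) w)"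
    by (rule sums_mult)
  moreover have "w * (of_nat n * of_real (a n) * w ^ (n - Suc 0)) = of_real (real n * a n) * w ^ n" for n
    by (cases n) (simp_all add: mult_ac)
  ultimately show ?thesis by (simp add: pseries_def sums_iff)
qed

context pos_root_limit
begin

context
  fixes a :: "nat \<Rightarrow> real"
  assumes e_eq: "\<And>n. e n = (2 * real n + 1) * a n"
begin

lemma entire_coeffs_a: "entire_coeffs a"
proof (rule entire_coeffs_mono[OF entire])
  show "\<bar>a n\<bar> \<le> \<bar>e n\<bar>" for n
    using mult_right_mono[of 1 "2 * real n + 1" "\<bar>a n\<bar>"] by (simp add: e_eq abs_mult)
qed

text \<open>The factor \<open>2 * real n + 1\<close> is the effect of the operator 1 + 2 w d/dw on
  \<open>w ^ n\<close>. It links \<open>a\<close>, which describes \<open>g\<close> and the Bessel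
  function, to \<open>e\<close>, for which the bounds hold.\<close>

lemma pseries_e_eq: "pseries e w = pseries a w + 2 * w * pseries (diffs a) w"
proof -
  have na: "entire_coeffs (\<lambda>n. real n * a n)"
  proof (rule entire_coeffs_mono[OF entire])
    show "\<bar>real n * a n\<bar> \<le> \<bar>e n\<bar>" for n
      by (simp add: e_eq abs_mult mult_right_mono)
  qed
  have "pseries e w = (\<Sum>n. of_real (a n) * w ^ n + 2 * (of_real (real n * a n) * w ^ n))"
    by (simp add: pseries_def e_eq algebra_simps)
  also have "\<dots> = pseries a w + 2 * pseries (\<lambda>n. real n * a n) w"
    unfolding pseries_def
    using entire_coeffs_summable[OF entire_coeffs_a, of w] entire_coeffs_summable[OF na, of w]
    by (simp only: suminf_add[symmetric] suminf_mult[symmetric] summable_mult)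
  finally show ?thesis by (simp add: pseries_of_nat_mult[OF entire_coeffs_a])
qed

lemma pseries_diffs_e_eq:
  "pseries (diffs e) w = 3 * pseries (diffs a) w + 2 * w * pseries (diffs (diffs a)) w"
proof (rule DERIV_unique[OF has_field_derivative_pseries[OF entire]])
  note [derivative_intros] = has_field_derivative_pseries[OF entire_coeffs_a]
    has_field_derivative_pseries[OF entire_coeffs_diffs[OF entire_coeffs_a]]
  have "pseries e = (\<lambda>w::'a. pseries a w + 2 * w * pseries (diffs a) w)"
    by (simp add: fun_eq_iff pseries_e_eq)
  then show "(pseries e has_field_derivative
      3 * pseries (diffs a) w + 2 * w * pseries (diffs (diffs a)) w) (at w)"
    by (auto intro!: derivative_eq_intros simp: algebra_simps)
qed

text \<open>With \<omega> = z g'' / g', a norm below 1/2 gives Re (1 + \<omega>) > 1/2 > |\<omega>|.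
  At \<open>sqrt w0\<close> the value is -1/2 and both sides of the required strict inequality equal
  1/2.\<close>

lemma radius_uc_eq:
  assumes g: "\<And>z. g z = z * pseries a (z\<^sup>2)"
    and w0: "0 < w0" "H w0 = 0" "\<And>t. 0 \<le> t \<Longrightarrow> t < w0 \<Longrightarrow> 0 < H t"
  shows "radius_uc g = sqrt w0"
proof -
  have dg: "(g has_field_derivative pseries e (z\<^sup>2)) (at z)" for z
  proof -
    have "((\<lambda>z. pseries a (z\<^sup>2)) has_field_derivative pseries (diffs a) (z\<^sup>2) * (2 * z)) (at z)"
      by (rule DERIV_chain2[OF has_field_derivative_pseries[OF entire_coeffs_a]])
        (auto intro!: derivative_eq_intros)
    moreover have "g = (\<lambda>z. z * pseries a (z\<^sup>2))" using g by (simp add: fun_eq_iff)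
    ultimately show ?thesis
      by (auto intro!: derivative_eq_intros simp: pseries_e_eq power2_eq_square algebra_simps)
  qed
  then have deriv1: "deriv g = (\<lambda>z. pseries e (z\<^sup>2))" by (simp add: fun_eq_iff DERIV_imp_deriv)
  have "((\<lambda>z::complex. pseries e (z\<^sup>2)) has_field_derivative pseries (diffs e) (z\<^sup>2) * (2 * z)) (at z)" for z
    by (rule DERIV_chain2[OF has_field_derivative_pseries[OF entire]])
      (auto intro!: derivative_eq_intros)
  then have deriv2: "deriv (deriv g) z = pseries (diffs e) (z\<^sup>2) * (2 * z)" for z
    unfolding deriv1 by (rule DERIV_imp_deriv)
  define \<omega> where "\<omega> = (\<lambda>z. z * deriv (deriv g) z / deriv g z)"
  have \<omega>: "\<omega> z = 2 * (z\<^sup>2 * pseries (diffs e) (z\<^sup>2) / pseries e (z\<^sup>2))" for z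
    unfolding \<omega>_def deriv2 by (simp add: deriv1 power2_eq_square)
  have inside: "deriv g z \<noteq> 0 \<and> Re (1 + \<omega> z) > cmod (\<omega> z)" if "cmod z < sqrt w0" for z
  proof -
    have "(cmod z)\<^sup>2 < (sqrt w0)\<^sup>2" using that by (intro power_strict_mono) auto
    then have "norm (z\<^sup>2) < w0" using w0 by (simp add: norm_power)
    from norm_log_deriv_less[OF w0(3) this]
    have nz: "pseries e (z\<^sup>2) \<noteq> 0"
      and less: "norm (z\<^sup>2 * pseries (diffs e) (z\<^sup>2) / pseries e (z\<^sup>2)) < 1 / 4"
      by auto
    have "cmod (\<omega> z) < 1 / 2" unfolding \<omega> norm_mult using less by simp
    then show ?thesis using nz abs_Re_le_cmod[of "\<omega> z"] by (auto simp: deriv1)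
  qed
  have boundary: "\<not> Re (1 + \<omega> (of_real (sqrt w0))) > cmod (\<omega> (of_real (sqrt w0)))"
  proof -
    have "0 < pseries e w0" by (rule pseries_pos_of_H_pos[OF w0(3)]) (use w0 in auto)
    then have "w0 * pseries (diffs e) w0 / pseries e w0 = - 1 / 4"
      using w0(2) by (simp add: H_def field_simps)
    moreover have "(complex_of_real (sqrt w0))\<^sup>2 = of_real w0"
      using w0(1) by (simp flip: of_real_power)
    ultimately have "\<omega> (of_real (sqrt w0)) = of_real (2 * (- 1 / 4))"
      unfolding \<omega> by (simp only: pseries_of_real[OF entire]
        pseries_of_real[OF entire_coeffs_diffs[OF entire]] flip: of_real_mult of_real_divide) simp
    then show ?thesis by simp
  qed
  \<comment> \<open>The discs are open, so the radius \<open>sqrt w0\<close> itself is admissible: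
    the critical point lies on its boundary.\<close>
  have "{r. r > 0 \<and> g holomorphic_on ball 0 r \<and> (\<forall>z\<in>ball 0 r. deriv g z \<noteq> 0 \<and>
      Re (1 + \<omega> z) > cmod (\<omega> z))} = {0<..sqrt w0}" (is "?S = _")
  proof (intro equalityI subsetI)
    fix r assume r: "r \<in> ?S"
    have "r \<le> sqrt w0"
    proof (rule ccontr)
      assume "\<not> r \<le> sqrt w0"
      then have "complex_of_real (sqrt w0) \<in> ball 0 r" using w0(1) by simp
      then show False using r boundary by blast
    qed
    then show "r \<in> {0<..sqrt w0}" using r by simp
  next
    fix r assume "r \<in> {0<..sqrt w0}"
    moreover have "g holomorphic_on ball 0 r"
      using dg by (auto simp: holomorphic_on_def field_differentiable_def
          intro: has_field_derivative_at_within)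
    ultimately show "r \<in> ?S" using inside by auto
  qed
  then have "radius_uc g = Sup {0<..sqrt w0}" unfolding radius_uc_def \<omega>_def by simp
  then show ?thesis using w0(1) by (simp add: cSup_greaterThanAtMost)
qed

text \<open>With A = \<open>pseries a\<close> and w = r^2, both sides reduce to
  \<open>K * r powr \<nu>\<close> times A + 14 w A' + 8 w^2 A''; all dependence on \<nu> in the
  bracket cancels.\<close>

lemma bessel_equation_eq:
  assumes J: "\<And>r. 0 < r \<Longrightarrow> J r = K * (r powr \<nu> * pseries a (r\<^sup>2))" and r: "0 < r"
  shows "(2 * \<nu> - 1) * (\<nu> - 1) * J r + (5 - 4 * \<nu>) * r * deriv J r + 2 * r\<^sup>2 * deriv (deriv J) r
    = K * r powr \<nu> * H (r\<^sup>2)"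
proof -
  have dser: "((\<lambda>r. pseries b (r\<^sup>2)) has_field_derivative pseries (diffs b) (r\<^sup>2) * (2 * r)) (at r)"
    if "entire_coeffs b" for b and r :: real
    by (rule DERIV_chain2[OF has_field_derivative_pseries[OF that]])
      (auto intro!: derivative_eq_intros)
  \<comment> \<open>Chosen so that r J'(r) = K r^\<nu> \<open>B r\<close>.\<close>
  define B where "B = (\<lambda>r. \<nu> * pseries a (r\<^sup>2) + 2 * r\<^sup>2 * pseries (diffs a) (r\<^sup>2))"
  \<comment> \<open>The formula for \<open>J\<close> is available for positive arguments only, so
    derivatives are transferred within the open half-line.\<close>
  have J1: "deriv J x = K * (x powr (\<nu> - 1) * B x)" if "0 < x" for x
  proof (rule DERIV_imp_deriv, rule has_field_derivative_transform_within_open[where S = "{0<..}"])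
    have "((\<lambda>r. K * (r powr \<nu> * pseries a (r\<^sup>2))) has_field_derivative
        K * (x powr \<nu> * (pseries (diffs a) (x\<^sup>2) * (2 * x)) + \<nu> * x powr (\<nu> - 1) * pseries a (x\<^sup>2))) (at x)"
      by (intro DERIV_cmult DERIV_mult' has_real_derivative_powr that dser entire_coeffs_a)
    moreover have "x powr \<nu> = x powr (\<nu> - 1) * x" using that by (simp add: powr_diff)
    ultimately show "((\<lambda>r. K * (r powr \<nu> * pseries a (r\<^sup>2))) has_field_derivative
        K * (x powr (\<nu> - 1) * B x)) (at x)"
      by (simp only: B_def power2_eq_square distrib_left mult_ac add_ac)
    show "open {0::real<..}" "x \<in> {0<..}" using that by auto
  qed (use J in auto)
  have J2: "deriv (deriv J) r = K * ((\<nu> - 1) * r powr (\<nu> - 2) * B r + r powr (\<nu> - 1) *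
      (2 * (\<nu> + 2) * r * pseries (diffs a) (r\<^sup>2) + 4 * r ^ 3 * pseries (diffs (diffs a)) (r\<^sup>2)))"
  proof (rule DERIV_imp_deriv, rule has_field_derivative_transform_within_open[where S = "{0<..}"])
    have "(B has_field_derivative \<nu> * (pseries (diffs a) (r\<^sup>2) * (2 * r))
        + (2 * r\<^sup>2 * (pseries (diffs (diffs a)) (r\<^sup>2) * (2 * r)) + 4 * r * pseries (diffs a) (r\<^sup>2))) (at r)"
      unfolding B_def
      by (intro DERIV_cmult DERIV_mult' DERIV_add dser entire_coeffs_diffs entire_coeffs_a)
        (auto intro!: derivative_eq_intros)
    then have "(B has_field_derivative 2 * (\<nu> + 2) * r * pseries (diffs a) (r\<^sup>2)
        + 4 * r ^ 3 * pseries (diffs (diffs a)) (r\<^sup>2)) (at r)"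
      by (rule DERIV_cong) (simp add: power2_eq_square power3_eq_cube algebra_simps)
    from DERIV_cmult[OF DERIV_mult'[OF has_real_derivative_powr[OF r, of "\<nu> - 1"] this], of K]
    show "((\<lambda>r. K * (r powr (\<nu> - 1) * B r)) has_field_derivative
        K * ((\<nu> - 1) * r powr (\<nu> - 2) * B r + r powr (\<nu> - 1) *
      (2 * (\<nu> + 2) * r * pseries (diffs a) (r\<^sup>2) + 4 * r ^ 3 * pseries (diffs (diffs a)) (r\<^sup>2)))) (at r)"
      by (rule DERIV_cong) (simp add: algebra_simps)
    show "open {0::real<..}" "r \<in> {0<..}" using r by auto
  qed (use J1 in auto)
  define p where "p = r powr \<nu>"
  have p: "r powr (\<nu> - 1) = p / r" "r powr (\<nu> - 2) = p / r\<^sup>2"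
    using r by (simp_all add: p_def powr_diff powr_numeral)
  have J0: "J r = K * (p * pseries a (r\<^sup>2))" using J[OF r] by (simp add: p_def)
  have "r * deriv J r = K * (p * B r)" using r by (simp add: J1 p)
  then have J1': "(5 - 4 * \<nu>) * r * deriv J r = (5 - 4 * \<nu>) * (K * (p * B r))"
    by (simp only: mult.assoc)
  have "r\<^sup>2 * deriv (deriv J) r = K * (p * ((\<nu> - 1) * B r +
      2 * (\<nu> + 2) * r\<^sup>2 * pseries (diffs a) (r\<^sup>2) + 4 * r ^ 4 * pseries (diffs (diffs a)) (r\<^sup>2)))"
    using r by (simp add: J2 p field_simps power_numeral_reduce)
  then have J2': "2 * r\<^sup>2 * deriv (deriv J) r = 2 * (K * (p * ((\<nu> - 1) * B r +
      2 * (\<nu> + 2) * r\<^sup>2 * pseries (diffs a) (r\<^sup>2) + 4 * r ^ 4 * pseries (diffs (diffs a)) (r\<^sup>2))))"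
    by (simp only: mult.assoc)
  have H: "H (r\<^sup>2) = pseries a (r\<^sup>2) + 14 * r\<^sup>2 * pseries (diffs a) (r\<^sup>2)
      + 8 * r ^ 4 * pseries (diffs (diffs a)) (r\<^sup>2)"
    by (simp add: H_def pseries_e_eq pseries_diffs_e_eq algebra_simps power_numeral_reduce)
  \<comment> \<open>The values of the series and the powers r^2 and r^4 are independent variables
    here, which leaves a polynomial identity.\<close>
  have "(2 * \<nu> - 1) * (\<nu> - 1) * (K * (p * A)) + (5 - 4 * \<nu>) * (K * (p * (\<nu> * A + 2 * w * A1)))
      + 2 * (K * (p * ((\<nu> - 1) * (\<nu> * A + 2 * w * A1) + 2 * (\<nu> + 2) * w * A1 + 4 * v * A2)))
      = K * p * (A + 14 * w * A1 + 8 * v * A2)" for A A1 A2 w v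
    by algebra
  then show ?thesis unfolding J0 J1' J2' H B_def p_def[symmetric] .
qed

text \<open>Since \<open>K * r powr \<nu>\<close> is nonzero for positive \<open>r\<close>, the
  equation says \<open>H (r\<^sup>2) = 0\<close>, and the first zero of \<open>H\<close> yields its
  least solution.\<close>

lemma radius_uc_first_root:
  assumes g: "\<And>z. g z = z * pseries a (z\<^sup>2)" and "K \<noteq> 0"
    and J: "\<And>r. 0 < r \<Longrightarrow> J r = K * (r powr \<nu> * pseries a (r\<^sup>2))"
  defines "Z \<equiv> {r. r > 0 \<and> (2 * \<nu> - 1) * (\<nu> - 1) * J r + (5 - 4 * \<nu>) * r * deriv J r
            + 2 * r\<^sup>2 * deriv (deriv J) r = 0}"
  shows "radius_uc g \<in> Z \<and> (\<forall>r\<in>Z. radius_uc g \<le> r)"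
proof -
  obtain w0 where w0: "0 < w0" "H w0 = 0" "\<And>t. 0 \<le> t \<Longrightarrow> t < w0 \<Longrightarrow> 0 < H t"
    using first_root_H by blast
  have Z: "r \<in> Z \<longleftrightarrow> 0 < r \<and> H (r\<^sup>2) = 0" for r
    using bessel_equation_eq[OF J, of r] \<open>K \<noteq> 0\<close> by (auto simp: Z_def)
  have "sqrt w0 \<le> r" if "r \<in> Z" for r
    using that w0(3)[of "r\<^sup>2"] by (force simp: Z intro: real_le_lsqrt)
  moreover have "radius_uc g = sqrt w0"
    by (rule radius_uc_eq[OF g w0(1,2)]) (rule w0(3))
  ultimately show ?thesis using w0(1,2) by (simp add: Z)
qed

end

end

section \<open>The Bessel coefficients as limits of polynomial coefficients\<close>

text \<open>Approximating and limiting coefficients share the factor \<open>t n\<close>. The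
  remaining factor \<open>d N n\<close> is nonnegative and bounded by its limit, because each
  \<open>1 - b * q ^ (N + k)\<close> lies in [0, 1]; so the limit serves as its own
  majorant.\<close>

lemma pos_root_limit_q_coeff:
  assumes q: "0 < q" "q < 1" and b: "0 \<le> b" "b < 1" and j: "j \<in> {1, 2}" and "0 < \<mu>"
  shows "\<exists>u. pos_root_limit (\<lambda>n. (2 * real n + 1) * q_coeff j q b \<mu> n) u"
proof -
  define t where "t = (\<lambda>n. (2 * real n + 1) * ((- 1) ^ n * \<mu> ^ n * (q ^ (n choose 2)) ^ j))"
  define d where "d = (\<lambda>N n. gauss_binom q N n * ((\<Prod>k<n. 1 - b * q ^ (N + k)) / qpoch b q n))"
  have "\<exists>u. (\<forall>i<N. 0 < u i) \<and> (\<forall>n. coeff (root_prod u N) n = t n * d N n)" for N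
    using q_coeff_approx[OF assms, of N] by (simp only: t_def d_def mult.assoc)
  then obtain u where u: "\<And>N i. i < N \<Longrightarrow> 0 < u N i"
    "\<And>N n. coeff (root_prod (u N) N) n = t n * d N n"
    by metis
  have e: "(2 * real n + 1) * q_coeff j q b \<mu> n = t n * (1 / qpoch q q n * (1 / qpoch b q n))" for n
    by (simp add: t_def q_coeff_def)
  have qp: "0 < qpoch q q n" "0 < qpoch b q n" for n
    using qpoch_pos[OF q q(2)] qpoch_pos[OF q b(2)] by auto
  have fac: "0 \<le> 1 - b * q ^ k" "1 - b * q ^ k \<le> 1" for k
    using mult_power_less_1[OF q b(2), of k] b q by auto
  have "pos_root_limit (\<lambda>n. (2 * real n + 1) * q_coeff j q b \<mu> n) u"
  proof
    show "entire_coeffs (\<lambda>n. (2 * real n + 1) * q_coeff j q b \<mu> n)"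
      unfolding entire_coeffs_def using q_coeff_summable[OF assms] by blast
    show "0 < u N i" if "i < N" for N i using u(1)[OF that] .
    show "\<bar>coeff (root_prod (u N) N) n\<bar> \<le> \<bar>(2 * real n + 1) * q_coeff j q b \<mu> n\<bar>" for N n
    proof -
      have prod: "0 \<le> (\<Prod>k<n. 1 - b * q ^ (N + k))" "(\<Prod>k<n. 1 - b * q ^ (N + k)) \<le> 1"
        using fac by (auto intro!: prod_nonneg prod_le_1)
      have "0 \<le> d N n"
        unfolding d_def using prod(1) qp(2)[of n] gauss_binom_nonneg[OF q, of N n] by simp
      moreover have "d N n \<le> 1 / qpoch q q n * (1 / qpoch b q n)"
        unfolding d_def using prod qp[of n]
        by (intro mult_mono gauss_binom_le[OF q] divide_right_mono) auto
      ultimately have "\<bar>d N n\<bar> \<le> \<bar>1 / qpoch q q n * (1 / qpoch b q n)\<bar>" by linarith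
      then show ?thesis unfolding u(2) e abs_mult[of "t n"] by (rule mult_left_mono) simp
    qed
    show "(\<lambda>N. coeff (root_prod (u N) N) n) \<longlonglongrightarrow> (2 * real n + 1) * q_coeff j q b \<mu> n" for n
    proof -
      have "(\<lambda>N. q ^ (N + k)) \<longlonglongrightarrow> 0" for k
        using q by (intro LIMSEQ_ignore_initial_segment LIMSEQ_realpow_zero) auto
      then have "(\<lambda>N. d N n) \<longlonglongrightarrow> 1 / qpoch q q n * ((\<Prod>k<n. 1 - b * 0) / qpoch b q n)"
        unfolding d_def using qp[of n] by (intro tendsto_intros gauss_binom_tendsto[OF q]) auto
      then show ?thesis unfolding u(2) e by (intro tendsto_mult_left) simp
    qed
    have "0 < (q ^ (1 choose 2)) ^ j" using q by simp
    then show "(2 * real 1 + 1) * q_coeff j q b \<mu> 1 \<noteq> 0"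
      using \<open>0 < \<mu>\<close> qp(1)[of 1] qp(2)[of 1] by (simp add: q_coeff_def)
  qed
  then show ?thesis by blast
qed

lemma qpoch_inf_nonzero:
  assumes "0 < q" "q < 1" "0 \<le> a" "a < 1"
  shows "qpoch_inf a q \<noteq> 0"
proof -
  have "summable (\<lambda>k. norm ((1 - a * q ^ k) - 1))"
    using assms by (simp add: abs_mult summable_mult)
  then have "convergent_prod (\<lambda>k. 1 - a * q ^ k)"
    by (intro abs_convergent_prod_imp_convergent_prod summable_imp_abs_convergent_prod)
  then show ?thesis
    unfolding qpoch_inf_def
    by (rule prodinf_nonzero) (use mult_power_less_1[OF assms(1,2,4)] in \<open>auto simp: less_le\<close>)
qed

lemma real_choose_two: "real (n choose 2) = real n * (real n - 1) / 2"
proof -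
  have "2 * real (n choose 2) = real n * (real n - 1)"
  proof (induction n)
    case (Suc n)
    have "2 * real (Suc n choose 2) = 2 * real n + 2 * real (n choose 2)"
      by (simp add: Suc_choose_two)
    then show ?case unfolding Suc.IH by (simp add: algebra_simps)
  qed (simp add: binomial_eq_0)
  then show ?thesis by simp
qed

text \<open>The exponent is 2 (n choose 2) + (\<nu> + 1) n, which explains \<open>j = 2\<close> and
  the power of \<open>b\<close> in the coefficients.\<close>

lemma q_powr_2:
  assumes "0 < q"
  shows "q powr (real n * (real n + \<nu>)) = (q ^ (n choose 2)) ^ 2 * (q powr (\<nu> + 1)) ^ n"
proof -
  have "real (n choose 2) * 2 = real n * real n - real n"
    by (simp add: real_choose_two right_diff_distrib)
  then have "real n * (real n + \<nu>) = real (n choose 2) * 2 + (\<nu> + 1) * real n"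
    by (simp add: algebra_simps)
  moreover have "q powr (real (n choose 2) * 2) = (q ^ (n choose 2)) ^ 2"
    using powr_powr[of q "real (n choose 2)" 2] assms by (simp add: powr_realpow)
  moreover have "q powr ((\<nu> + 1) * real n) = (q powr (\<nu> + 1)) ^ n"
    using powr_powr[of q "\<nu> + 1" "real n"] assms by (simp add: powr_realpow)
  ultimately show ?thesis by (simp only: powr_add[of q "real (n choose 2) * 2"])
qed

lemma q_powr_3:
  assumes "0 < q"
  shows "q powr (real n * (real n + 1) / 2) = q ^ (n choose 2) * q ^ n"
proof -
  have *: "real n * (real n + 1) / 2 = real (n choose 2) + real n"
    by (simp add: real_choose_two field_simps)
  show ?thesis unfolding * using assms by (simp add: powr_add powr_realpow)
qed

lemma powr_even_add:
  assumes "z \<noteq> (0::complex)"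
  shows "z powr of_real (2 * real n + \<nu>) = z powr of_real \<nu> * (z\<^sup>2) ^ n"
proof -
  have "z powr of_real (2 * real n + \<nu>) = z powr of_real \<nu> * z powr of_nat (2 * n)"
    by (simp add: powr_add[symmetric] add.commute)
  also have "z powr of_nat (2 * n) = (z\<^sup>2) ^ n"
    using assms by (subst powr_nat') (simp_all add: power_mult)
  finally show ?thesis .
qed

lemma powr_even_add_real:
  assumes "(r::real) > 0"
  shows "r powr (2 * real n + \<nu>) = r powr \<nu> * (r\<^sup>2) ^ n"
proof -
  have "r powr (2 * real n + \<nu>) = r powr \<nu> * r powr real (2 * n)"
    by (simp add: powr_add[symmetric] add.commute)
  then show ?thesis using assms by (simp only: powr_realpow power_mult)
qed

text \<open>Division by a positive real leaves the argument unchanged, so the principal branch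
  causes no correction.\<close>

lemma half_powr:
  assumes "z \<noteq> (0::complex)"
  shows "(z / 2) powr of_real \<nu> = z powr of_real \<nu> * of_real (2 powr - \<nu>)"
proof -
  have "Ln (z / 2) = Ln z - of_real (ln 2)"
    using Ln_divide_of_real[of 2 z] assms by simp
  then have "(z / 2) powr of_real \<nu> = exp (of_real \<nu> * Ln z + of_real (- \<nu> * ln 2))"
    using assms by (simp add: powr_def right_diff_distrib)
  also have "\<dots> = exp (of_real \<nu> * Ln z) * of_real (exp (- \<nu> * ln 2))"
    by (simp only: exp_add exp_of_real)
  finally show ?thesis using assms by (simp add: powr_def)
qed

subsection \<open>The \<open>q\<close>-Bessel functions\<close>

lemma cnu_nonzero:
  assumes "0 < q" "q < 1" "-1 < \<nu>"
  shows "cnu \<nu> q \<noteq> 0"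
proof -
  have "0 \<le> q powr (\<nu> + 1)" "q powr (\<nu> + 1) < 1"
    using assms powr_less_mono'[of q 0 "\<nu> + 1"] by auto
  then show ?thesis
    using assms qpoch_inf_nonzero[of q q] qpoch_inf_nonzero[of q "q powr (\<nu> + 1)"]
    by (simp add: cnu_def)
qed

lemma powr_sum_eq_pseries:
  assumes "entire_coeffs a" "z \<noteq> 0" "\<And>n. f n = a n"
  shows "(\<Sum>n. of_real (f n) * z powr of_real (2 * real n + \<nu>))
    = z powr of_real \<nu> * (pseries a (z\<^sup>2) :: complex)"
proof -
  have "(\<Sum>n. of_real (f n) * z powr of_real (2 * real n + \<nu>))
      = (\<Sum>n. z powr of_real \<nu> * (of_real (a n) * (z\<^sup>2) ^ n))"
    unfolding powr_even_add[OF assms(2)] assms(3) by (simp only: mult_ac)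
  then show ?thesis
    by (simp only: suminf_mult[OF entire_coeffs_summable[OF assms(1)]] pseries_def)
qed

lemma powr_sum_eq_pseries_real:
  assumes "entire_coeffs a" "0 < r" "\<And>n. f n = a n"
  shows "(\<Sum>n. f n * r powr (2 * real n + \<nu>)) = r powr \<nu> * (pseries a (r\<^sup>2) :: real)"
proof -
  have "(\<Sum>n. f n * r powr (2 * real n + \<nu>)) = (\<Sum>n. r powr \<nu> * (of_real (a n) * (r\<^sup>2) ^ n))"
    unfolding powr_even_add_real[OF assms(2)] assms(3) by (simp add: mult_ac)
  then show ?thesis
    by (simp only: suminf_mult[OF entire_coeffs_summable[OF assms(1)]] pseries_def)
qed

lemma pseries_rescale: "pseries (\<lambda>n. a n * c ^ n) w = pseries a (of_real c * w)"
  by (simp add: pseries_def power_mult_distrib mult.assoc)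

lemma entire_coeffs_rescale:
  assumes "entire_coeffs a"
  shows "entire_coeffs (\<lambda>n. a n * c ^ n)"
proof -
  have "summable (\<lambda>n. \<bar>a n * c ^ n\<bar> * R ^ n)" for R
    using assms unfolding entire_coeffs_def
    by (drule_tac x = "\<bar>c\<bar> * R" in spec) (simp add: abs_mult power_abs power_mult_distrib mult.assoc)
  then show ?thesis by (simp add: entire_coeffs_def)
qed

text \<open>Both powers use the same logarithm; thus the branch cut cancels in \<open>qg\<close>,
  which becomes entire.\<close>

lemma powr_one_minus_mult:
  assumes "z \<noteq> (0::complex)"
  shows "z powr of_real (1 - \<nu>) * z powr of_real \<nu> = z"
  using assms by (simp flip: powr_add)

lemma q_bessel_2_series:
  assumes q: "0 < q" "q < 1" "-1 < \<nu>"
  defines "b \<equiv> q powr (\<nu> + 1)"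
  defines "a \<equiv> q_coeff 2 q b (b / 4)"
  assumes ent: "entire_coeffs a"
  shows "qg 2 \<nu> q z = z * pseries a (z\<^sup>2)"
    and "0 < r \<Longrightarrow> qJr 2 \<nu> q r = (2 powr - \<nu> / cnu \<nu> q) * (r powr \<nu> * pseries a (r\<^sup>2))"
proof -
  \<comment> \<open>The defining series is in powers of \<open>z / 2\<close>; the factor
    \<open>4 ^ n\<close> compensates the square of 1/2 and the 4 in \<open>b / 4\<close>.\<close>
  define a4 where "a4 = (\<lambda>n. a n * 4 ^ n)"
  have a4: "(- 1) ^ n * q powr (real n * (real n + \<nu>)) / (qpoch q q n * qpoch (q powr (\<nu> + 1)) q n) = a4 n" for n
    by (simp add: a4_def a_def b_def q_coeff_def q_powr_2[OF q(1)] power_divide mult_ac)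
  have ent4: "entire_coeffs a4"
    unfolding a4_def by (rule entire_coeffs_rescale[OF ent])
  have half: "pseries a4 ((z / 2)\<^sup>2) = pseries a (z\<^sup>2)" for z :: complex
    unfolding a4_def pseries_rescale by (simp add: power_divide)
  have halfr: "pseries a4 ((r / 2)\<^sup>2) = pseries a (r\<^sup>2)" for r :: real
    unfolding a4_def pseries_rescale by (simp add: power_divide)
  note c = cnu_nonzero[OF q]
  \<comment> \<open>At \<open>z = 0\<close> the convention that \<open>powr\<close> has value 0 at
    base 0 makes \<open>qg\<close> vanish, as it should.\<close>
  show "qg 2 \<nu> q z = z * pseries a (z\<^sup>2)"
  proof (cases "z = 0")
    case False
    have "qg 2 \<nu> q z = of_real (2 powr \<nu> * cnu \<nu> q) * z powr of_real (1 - \<nu>) *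
        (of_real (1 / cnu \<nu> q) * ((z / 2) powr of_real \<nu> * pseries a (z\<^sup>2)))"
      using powr_sum_eq_pseries[OF ent4 _ a4, of "z / 2" \<nu>] False
      unfolding qg_def qJ_def by (simp add: half del: of_real_add of_real_mult of_real_divide)
    also have "\<dots> = of_real (2 powr \<nu> * cnu \<nu> q * (1 / cnu \<nu> q) * 2 powr - \<nu>)
        * (z powr of_real (1 - \<nu>) * z powr of_real \<nu>) * pseries a (z\<^sup>2)"
      unfolding half_powr[OF False] by (simp only: of_real_mult mult_ac)
    also have "2 powr \<nu> * cnu \<nu> q * (1 / cnu \<nu> q) * 2 powr - \<nu> = 1"
      using c by (simp flip: powr_add)
    finally show ?thesis by (simp only: powr_one_minus_mult[OF False]) simp
  qed (simp add: qg_def)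
  show "qJr 2 \<nu> q r = (2 powr - \<nu> / cnu \<nu> q) * (r powr \<nu> * pseries a (r\<^sup>2))" if "0 < r"
  proof -
    have "qJr 2 \<nu> q r = (1 / cnu \<nu> q) * ((r / 2) powr \<nu> * pseries a (r\<^sup>2))"
      using powr_sum_eq_pseries_real[OF ent4 _ a4, of "r / 2" \<nu>] that
      unfolding qJr_def by (simp add: halfr)
    then show ?thesis using that by (simp add: powr_divide powr_minus field_simps)
  qed
qed

lemma q_bessel_3_series:
  assumes q: "0 < q" "q < 1" "-1 < \<nu>"
  defines "a \<equiv> q_coeff 1 q (q powr (\<nu> + 1)) q"
  assumes ent: "entire_coeffs a"
  shows "qg 3 \<nu> q z = z * pseries a (z\<^sup>2)"
    and "0 < r \<Longrightarrow> qJr 3 \<nu> q r = (1 / cnu \<nu> q) * (r powr \<nu> * pseries a (r\<^sup>2))"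
proof -
  have a: "(- 1) ^ n * q powr (real n * (real n + 1) / 2) / (qpoch q q n * qpoch (q powr (\<nu> + 1)) q n) = a n" for n
    by (simp add: a_def q_coeff_def q_powr_3[OF q(1)] mult_ac)
  note c = cnu_nonzero[OF q]
  show "qg 3 \<nu> q z = z * pseries a (z\<^sup>2)"
  proof (cases "z = 0")
    case False
    have "qg 3 \<nu> q z = of_real (cnu \<nu> q) * z powr of_real (1 - \<nu>) *
        (of_real (1 / cnu \<nu> q) * (z powr of_real \<nu> * pseries a (z\<^sup>2)))"
      using powr_sum_eq_pseries[OF ent False a, of \<nu>]
      unfolding qg_def qJ_def by (simp del: of_real_add of_real_mult of_real_divide)
    also have "\<dots> = of_real (cnu \<nu> q * (1 / cnu \<nu> q))
        * (z powr of_real (1 - \<nu>) * z powr of_real \<nu>) * pseries a (z\<^sup>2)"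
      by (simp only: of_real_mult mult_ac)
    also have "cnu \<nu> q * (1 / cnu \<nu> q) = 1" using c by simp
    finally show ?thesis by (simp only: powr_one_minus_mult[OF False]) simp
  qed (simp add: qg_def)
  show "qJr 3 \<nu> q r = (1 / cnu \<nu> q) * (r powr \<nu> * pseries a (r\<^sup>2))" if "0 < r"
    using powr_sum_eq_pseries_real[OF ent that a, of \<nu>] unfolding qJr_def by simp
qed

theorem theorem2:
  fixes q \<nu> :: real and s :: nat
  assumes "0 < q" "q < 1" "\<nu> > -1" "s \<in> {2, 3}"
  shows "radius_uc (qg s \<nu> q) \<in> {r. r > 0 \<and>
            (2 * \<nu> - 1) * (\<nu> - 1) * qJr s \<nu> q r
            + (5 - 4 * \<nu>) * r * deriv (qJr s \<nu> q) r
            + 2 * r\<^sup>2 * deriv (deriv (qJr s \<nu> q)) r = 0}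
       \<and> (\<forall>r\<in>{r. r > 0 \<and>
            (2 * \<nu> - 1) * (\<nu> - 1) * qJr s \<nu> q r
            + (5 - 4 * \<nu>) * r * deriv (qJr s \<nu> q) r
            + 2 * r\<^sup>2 * deriv (deriv (qJr s \<nu> q)) r = 0}.
            radius_uc (qg s \<nu> q) \<le> r)"
proof -
  define b where "b = q powr (\<nu> + 1)"
  have b: "0 < b" "b < 1"
    using assms powr_less_mono'[of q 0 "\<nu> + 1"] by (auto simp: b_def)
  have c: "cnu \<nu> q \<noteq> 0" using cnu_nonzero assms by blast
  consider "s = 2" | "s = 3" using assms by auto
  then show ?thesis
  proof cases
    case 1
    \<comment> \<open>Here \<open>\<mu> = b / 4\<close>: \<open>b ^ n\<close> is part of the power
      of \<open>q\<close> in the series, and 1/4 stems from the argument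
      \<open>z / 2\<close>.\<close>
    obtain u where "pos_root_limit (\<lambda>n. (2 * real n + 1) * q_coeff 2 q b (b / 4) n) u"
      using pos_root_limit_q_coeff[of q b 2 "b / 4"] assms b by auto
    then interpret pos_root_limit "\<lambda>n. (2 * real n + 1) * q_coeff 2 q b (b / 4) n" u .
    note ent = entire_coeffs_a[OF refl]
    show ?thesis
      using c q_bessel_2_series[OF assms(1-3) ent[unfolded b_def]] unfolding 1
      by (intro radius_uc_first_root[OF refl, where K = "2 powr - \<nu> / cnu \<nu> q"])
        (auto simp: b_def)
  next
    case 2
    obtain u where "pos_root_limit (\<lambda>n. (2 * real n + 1) * q_coeff 1 q b q n) u"
      using pos_root_limit_q_coeff[of q b 1 q] assms b by auto
    then interpret pos_root_limit "\<lambda>n. (2 * real n + 1) * q_coeff 1 q b q n" u .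
    note ent = entire_coeffs_a[OF refl]
    show ?thesis
      using c q_bessel_3_series[OF assms(1-3) ent[unfolded b_def]] unfolding 2
      by (intro radius_uc_first_root[OF refl, where K = "1 / cnu \<nu> q"])
        (auto simp: b_def)
  qed
qed

end
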